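(* Let $G$ be a Poisson–Lie group whose Lie bialgebra $\mathfrak g$ is quasitriangular, with quasitriangular structure $r$ and $r_-=\frac12(r-r_{21})=r_-^{[1]}\otimes r_-^{[2]}$. A left invariant preconnection on $G$, given by $\Xi:\mathfrak g^*\otimes\mathfrak g^*\to\mathfrak g^*$, is compatible if and only if the map $\hat\Xi:\mathfrak g^*\otimes\mathfrak g^*\to\mathfrak g^*$ defined by $$\hat\Xi(\phi,\psi)=\Xi(\phi,\psi)-\phi(r_-^{[1]})\,\mathrm{ad}^*_{r_-^{[2]}}\psi$$ is symmetric. Here $(\mathrm{ad}^*_v\psi)(w)=\psi([w,v])$.
   Context: $G$ is a Poisson–Lie group with Lie algebra $\mathfrak g=T_eG$. For $v\in\mathfrak g$, $gv$ and $vg$ denote its images in $T_gG$ under left and right translation. The Poisson bivector is written $\omega=\omega^{[1]}\otimes\omega^{[2]}$ (summation understood), $\{a,b\}(g)=a'(g;\omega^{[1]}(g))\,b'(g;\omega^{[2]}(g))$, where $a'(g;u)$ is the derivative of $a$ at $g$ in the direction $u\in T_gG$; the same notation is used for vector-valued functions. Quasitriangular: the Lie cobracket is $\delta v=\mathrm{ad}_v(r)=[v,r^{[1]}]\otimes r^{[2]}+r^{[1]}\otimes[v,r^{[2]}]$ for an $r\in\mathfrak g\otimes\mathfrak g$ satisfying $[r_{12},r_{13}]+[r_{12},r_{23}]+[r_{13},r_{23}]=0$; then $r_+=\frac12(r+r_{21})$ is ad-invariant and $\omega(g)=g\,r-r\,g$. A preconnection is a (bilinear) map $\gamma:C^\infty(G)\times\Omega^1(G)\to\Omega^1(G)$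 with $\gamma(xy,\tau)=x\gamma(y,\tau)+\gamma(x,\tau)y$ and $\gamma(x,\tau y)=\gamma(x,\tau)y+\tau\{x,y\}$. It is compatible if $\mathrm{d}\{x,y\}=\gamma(x,\mathrm{d}y)-\gamma(y,\mathrm{d}x)$ for all functions $x,y$. A $1$-form $\tau$ is identified with the $\mathfrak g^*$-valued function $\tilde\tau(g)=L_g^*(\tau(g))$ (i.e. $\tilde\tau(g)(v)=\tau(g)(gv)$), and $\tilde\gamma(a,\tilde\tau)=\widetilde{\gamma(a,\tau)}$. One defines $\Xi$ by $\tilde\gamma(a,s)(g)=\{a,s\}(g)+\Xi(g,\hat L_a(g),s(g))$ for $s\in C^\infty(G,\mathfrak g^* )$, where $\{a,s\}$ is the Poisson bracket extended to $\mathfrak g^*$-valued functions and $\hat L_a(g)(v)=a'(g;gv)$. The preconnection is left invariant exactly when $\Xi$ does not depend on $g$, in which case it is given by a bilinear map $\Xi:\mathfrak g^*\otimes\mathfrak g^*\to\mathfrak g^*$. *)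

theory Defs
  imports "HOL-Analysis.Analysis" "HOL-Algebra.Group"
begin

section \<open>Smooth maps and manifolds\<close>

text \<open>Used for open \<open>S\<close> in finite-dimensional spaces only, where it is the usual
  notion of a \<open>k\<close> times continuously differentiable map.\<close>

primrec Ck_on :: "nat \<Rightarrow> 'a::real_normed_vector set \<Rightarrow> ('a \<Rightarrow> 'b::real_normed_vector) \<Rightarrow> bool" where
  "Ck_on 0 S f \<longleftrightarrow> continuous_on S f"
| "Ck_on (Suc k) S f \<longleftrightarrow> (\<forall>x\<in>S. f differentiable (at x)) \<and>
     (\<forall>w. Ck_on k S (\<lambda>x. frechet_derivative f (at x) w))"

definition smooth_on :: "'a::real_normed_vector set \<Rightarrow> ('a \<Rightarrow> 'b::real_normed_vector) \<Rightarrow> bool" where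
  "smooth_on S f \<longleftrightarrow> (\<forall>k. Ck_on k S f)"

text \<open>A chart is a pair \<open>(U, \<phi>)\<close>; the values of \<open>\<phi>\<close> outside \<open>U\<close> are irrelevant, and the
  inverse of the chart is \<open>inv_into U \<phi>\<close>.\<close>

type_synonym ('m, 'e) chart = "'m set \<times> ('m \<Rightarrow> 'e)"

definition smooth_atlas :: "('m::topological_space, 'e::euclidean_space) chart set \<Rightarrow> bool" where
  "smooth_atlas A \<longleftrightarrow>
     (\<forall>(U, \<phi>)\<in>A. open U \<and> open (\<phi> ` U) \<and> homeomorphism U (\<phi> ` U) \<phi> (inv_into U \<phi>)) \<and>
     (\<Union>(U, \<phi>)\<in>A. U) = UNIV \<and>
     (\<forall>(U, \<phi>)\<in>A. \<forall>(V, \<psi>)\<in>A. smooth_on (\<phi> ` (U \<inter> V)) (\<psi> \<circ> inv_into U \<phi>))"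

definition smooth_map :: "('m::topological_space, 'e::euclidean_space) chart set \<Rightarrow>
    ('n::topological_space, 'f::euclidean_space) chart set \<Rightarrow> ('m \<Rightarrow> 'n) \<Rightarrow> bool" where
  "smooth_map A B f \<longleftrightarrow> continuous_on UNIV f \<and>
     (\<forall>(U, \<phi>)\<in>A. \<forall>(V, \<psi>)\<in>B. smooth_on (\<phi> ` (U \<inter> f -` V)) (\<psi> \<circ> f \<circ> inv_into U \<phi>))"

definition prod_atlas :: "('m, 'e) chart set \<Rightarrow> ('n, 'f) chart set \<Rightarrow> ('m \<times> 'n, 'e \<times> 'f) chart set" where
  "prod_atlas A B = {(U \<times> V, map_prod \<phi> \<psi>) | U \<phi> V \<psi>. (U, \<phi>) \<in> A \<and> (V, \<psi>) \<in> B}"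


section \<open>Lie groups\<close>

text \<open>The topology is that of the type \<open>'g\<close>, so the underlying set of the group is all of \<open>'g\<close>.\<close>

record ('g, 'e) lie_group = "'g monoid" +
  atlas :: "('g, 'e) chart set"

definition lie_group ::
    "('g::{t2_space, second_countable_topology}, 'e::euclidean_space) lie_group \<Rightarrow> bool" where
  "lie_group G \<longleftrightarrow> group G \<and> carrier G = UNIV \<and> smooth_atlas (atlas G) \<and>
     smooth_map (prod_atlas (atlas G) (atlas G)) (atlas G) (\<lambda>(x, y). x \<otimes>\<^bsub>G\<^esub> y) \<and>
     smooth_map (atlas G) (atlas G) (\<lambda>x. inv\<^bsub>G\<^esub> x)"

definition C_inf :: "('g, 'e::euclidean_space) lie_group \<Rightarrow> ('g \<Rightarrow> real) set" where
  "C_inf G = {f. \<forall>(U, \<phi>)\<in>atlas G. smooth_on (\<phi> ` U) (f \<circ> inv_into U \<phi>)}"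

text \<open>Tangent vectors are derivations of the algebra of smooth functions. They are extended by \<open>0\<close> to
  non-smooth functions, which makes each derivation a unique HOL function; the vector space
  operations are pointwise. The derivative \<open>a'(g; u)\<close> of \<open>a\<close> in the direction \<open>u\<close> is \<open>u a\<close>.\<close>

type_synonym 'g tvec = "('g \<Rightarrow> real) \<Rightarrow> real"

definition tangent_space :: "('g, 'e::euclidean_space) lie_group \<Rightarrow> 'g \<Rightarrow> 'g tvec set" where
  "tangent_space G p = {v.
     (\<forall>f\<in>C_inf G. \<forall>h\<in>C_inf G. v (\<lambda>x. f x + h x) = v f + v h) \<and>
     (\<forall>f\<in>C_inf G. \<forall>c. v (\<lambda>x. c * f x) = c * v f) \<and>
     (\<forall>f\<in>C_inf G. \<forall>h\<in>C_inf G. v (\<lambda>x. f x * h x) = f p * v h + v f * h p) \<and>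
     (\<forall>f. f \<notin> C_inf G \<longrightarrow> v f = 0)}"

text \<open>The image \<open>g v\<close> (resp. \<open>v g\<close>) of a tangent vector under left (resp. right) translation by \<open>g\<close>.\<close>

definition ltrans :: "('g, 'e) lie_group \<Rightarrow> 'g \<Rightarrow> 'g tvec \<Rightarrow> 'g tvec" where
  "ltrans G g v = (\<lambda>f. v (\<lambda>x. f (g \<otimes>\<^bsub>G\<^esub> x)))"

definition rtrans :: "('g, 'e) lie_group \<Rightarrow> 'g \<Rightarrow> 'g tvec \<Rightarrow> 'g tvec" where
  "rtrans G g v = (\<lambda>f. v (\<lambda>x. f (x \<otimes>\<^bsub>G\<^esub> g)))"

definition lie_algebra :: "('g, 'e::euclidean_space) lie_group \<Rightarrow> 'g tvec set" where
  "lie_algebra G = tangent_space G \<one>\<^bsub>G\<^esub>"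

text \<open>The bracket is the value at the identity of the commutator of the left invariant vector fields
  \<open>g \<mapsto> g v\<close> and \<open>g \<mapsto> g w\<close>.\<close>

definition lie_bracket :: "('g, 'e) lie_group \<Rightarrow> 'g tvec \<Rightarrow> 'g tvec \<Rightarrow> 'g tvec" where
  "lie_bracket G v w = (\<lambda>f. v (\<lambda>g. ltrans G g w f) - w (\<lambda>g. ltrans G g v f))"

text \<open>Linear functionals on a tangent space, extended by \<open>0\<close>.\<close>

definition cotangent_space :: "('g, 'e::euclidean_space) lie_group \<Rightarrow> 'g \<Rightarrow> ('g tvec \<Rightarrow> real) set" where
  "cotangent_space G p = {\<phi>.
     (\<forall>v\<in>tangent_space G p. \<forall>w\<in>tangent_space G p. \<phi> (\<lambda>f. v f + w f) = \<phi> v + \<phi> w) \<and>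
     (\<forall>v\<in>tangent_space G p. \<forall>c. \<phi> (\<lambda>f. c * v f) = c * \<phi> v) \<and>
     (\<forall>v. v \<notin> tangent_space G p \<longrightarrow> \<phi> v = 0)}"

definition lie_dual :: "('g, 'e::euclidean_space) lie_group \<Rightarrow> ('g tvec \<Rightarrow> real) set" where
  "lie_dual G = cotangent_space G \<one>\<^bsub>G\<^esub>"

definition coadjoint :: "('g, 'e::euclidean_space) lie_group \<Rightarrow> 'g tvec \<Rightarrow>
    ('g tvec \<Rightarrow> real) \<Rightarrow> ('g tvec \<Rightarrow> real)" where
  "coadjoint G v \<psi> = (\<lambda>w. if w \<in> lie_algebra G then \<psi> (lie_bracket G w v) else 0)"


section \<open>Vector fields and one-forms\<close>

definition vector_fields :: "('g, 'e::euclidean_space) lie_group \<Rightarrow> ('g \<Rightarrow> 'g tvec) set" where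
  "vector_fields G = {X. (\<forall>p. X p \<in> tangent_space G p) \<and>
     (\<forall>f\<in>C_inf G. (\<lambda>p. X p f) \<in> C_inf G)}"

type_synonym 'g form = "'g \<Rightarrow> 'g tvec \<Rightarrow> real"

definition one_forms :: "('g, 'e::euclidean_space) lie_group \<Rightarrow> 'g form set" where
  "one_forms G = {\<tau>. (\<forall>p. \<tau> p \<in> cotangent_space G p) \<and>
     (\<forall>X\<in>vector_fields G. (\<lambda>p. \<tau> p (X p)) \<in> C_inf G)}"

definition differential :: "('g, 'e::euclidean_space) lie_group \<Rightarrow> ('g \<Rightarrow> real) \<Rightarrow> 'g form" where
  "differential G a = (\<lambda>p u. if u \<in> tangent_space G p then u a else 0)"

text \<open>The dual-of-the-Lie-algebra-valued function corresponding to a one-form.\<close>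

definition tilde :: "('g, 'e) lie_group \<Rightarrow> 'g form \<Rightarrow> ('g \<Rightarrow> 'g tvec \<Rightarrow> real)" where
  "tilde G \<tau> = (\<lambda>g v. \<tau> g (ltrans G g v))"

definition Lhat :: "('g, 'e::euclidean_space) lie_group \<Rightarrow> ('g \<Rightarrow> real) \<Rightarrow> ('g \<Rightarrow> 'g tvec \<Rightarrow> real)" where
  "Lhat G a = (\<lambda>g v. differential G a g (ltrans G g v))"


section \<open>Tensors\<close>

text \<open>An element of \<open>V \<otimes> W\<close>, for tangent spaces \<open>V\<close> and \<open>W\<close>, is written as a finite formal sum of
  simple tensors, i.e. a list of pairs. As tangent vectors are separated by the functions on which
  they act, two formal sums denote the same tensor iff they agree as operators on pairs of functions,
  that is, iff their images under \<open>tensor2\<close> are equal; similarly for \<open>tensor3\<close>.\<close>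

type_synonym 'g tens2 = "('g tvec \<times> 'g tvec) list"
type_synonym 'g tens3 = "('g tvec \<times> 'g tvec \<times> 'g tvec) list"

definition tensor2 :: "'g tens2 \<Rightarrow> ('g \<Rightarrow> real) \<Rightarrow> ('g \<Rightarrow> real) \<Rightarrow> real" where
  "tensor2 t = (\<lambda>a b. \<Sum>(u, v)\<leftarrow>t. u a * v b)"

definition tensor3 :: "'g tens3 \<Rightarrow> ('g \<Rightarrow> real) \<Rightarrow> ('g \<Rightarrow> real) \<Rightarrow> ('g \<Rightarrow> real) \<Rightarrow> real" where
  "tensor3 t = (\<lambda>a b c. \<Sum>(u, v, w)\<leftarrow>t. u a * v b * w c)"

definition ad_tensor :: "('g, 'e) lie_group \<Rightarrow> 'g tvec \<Rightarrow> 'g tens2 \<Rightarrow> 'g tens2" where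
  "ad_tensor G v r = map (\<lambda>(p, q). (lie_bracket G v p, q)) r @ map (\<lambda>(p, q). (p, lie_bracket G v q)) r"

text \<open>\<open>[r\<^sub>1\<^sub>2, r\<^sub>1\<^sub>3] + [r\<^sub>1\<^sub>2, r\<^sub>2\<^sub>3] + [r\<^sub>1\<^sub>3, r\<^sub>2\<^sub>3]\<close>\<close>

definition cybe_tensor :: "('g, 'e) lie_group \<Rightarrow> 'g tens2 \<Rightarrow> 'g tens3" where
  "cybe_tensor G r =
     [(lie_bracket G p p', q, q'). (p, q) \<leftarrow> r, (p', q') \<leftarrow> r] @
     [(p, lie_bracket G q p', q'). (p, q) \<leftarrow> r, (p', q') \<leftarrow> r] @
     [(p, p', lie_bracket G q q'). (p, q) \<leftarrow> r, (p', q') \<leftarrow> r]"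

text \<open>\<open>r\<^sub>- = (r - r\<^sub>2\<^sub>1) / 2\<close>\<close>

definition r_minus :: "'g tens2 \<Rightarrow> 'g tens2" where
  "r_minus r = map (\<lambda>(p, q). (\<lambda>f. p f / 2, q)) r @ map (\<lambda>(p, q). (\<lambda>f. - q f / 2, p)) r"


section \<open>Poisson-Lie groups\<close>

definition poisson_bracket :: "('g \<Rightarrow> 'g tens2) \<Rightarrow> ('g \<Rightarrow> real) \<Rightarrow> ('g \<Rightarrow> real) \<Rightarrow> ('g \<Rightarrow> real)" where
  "poisson_bracket \<omega> a b = (\<lambda>g. tensor2 (\<omega> g) a b)"

definition poisson_bivector :: "('g, 'e::euclidean_space) lie_group \<Rightarrow> ('g \<Rightarrow> 'g tens2) \<Rightarrow> bool" where
  "poisson_bivector G \<omega> \<longleftrightarrow>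
     (\<forall>g. set (\<omega> g) \<subseteq> tangent_space G g \<times> tangent_space G g) \<and>
     (\<forall>a\<in>C_inf G. \<forall>b\<in>C_inf G. poisson_bracket \<omega> a b \<in> C_inf G) \<and>
     (\<forall>a\<in>C_inf G. \<forall>b\<in>C_inf G. \<forall>g. poisson_bracket \<omega> a b g = - poisson_bracket \<omega> b a g) \<and>
     (\<forall>a\<in>C_inf G. \<forall>b\<in>C_inf G. \<forall>c\<in>C_inf G. \<forall>g.
        poisson_bracket \<omega> a (poisson_bracket \<omega> b c) g +
        poisson_bracket \<omega> b (poisson_bracket \<omega> c a) g +
        poisson_bracket \<omega> c (poisson_bracket \<omega> a b) g = 0)"

text \<open>The last condition is multiplicativity, \<open>\<omega>(g h) = g \<omega>(h) + \<omega>(g) h\<close>, i.e. the multiplication is a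
  Poisson map.\<close>

definition poisson_lie_group ::
    "('g::{t2_space, second_countable_topology}, 'e::euclidean_space) lie_group \<Rightarrow>
     ('g \<Rightarrow> 'g tens2) \<Rightarrow> bool" where
  "poisson_lie_group G \<omega> \<longleftrightarrow> lie_group G \<and> poisson_bivector G \<omega> \<and>
     (\<forall>g h. tensor2 (\<omega> (g \<otimes>\<^bsub>G\<^esub> h)) =
        tensor2 (map (map_prod (ltrans G g) (ltrans G g)) (\<omega> h) @
                 map (map_prod (rtrans G h) (rtrans G h)) (\<omega> g)))"

text \<open>The cobracket \<open>\<delta> v\<close> of the Lie bialgebra of a Poisson-Lie group, as an operator on pairs of
  functions like \<open>tensor2\<close>. It is the derivative of \<open>\<omega>\<close> at the identity in the direction \<open>v\<close>
  (which needs no trivialisation as \<open>\<omega>\<close> vanishes there), and its transpose is the bracket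
  \<open>[d\<^sub>e a, d\<^sub>e b] = d\<^sub>e {a, b}\<close> on the dual of the Lie algebra.\<close>

definition cobracket :: "('g \<Rightarrow> 'g tens2) \<Rightarrow> 'g tvec \<Rightarrow> ('g \<Rightarrow> real) \<Rightarrow> ('g \<Rightarrow> real) \<Rightarrow> real" where
  "cobracket \<omega> v = (\<lambda>a b. v (poisson_bracket \<omega> a b))"

definition quasitriangular_structure :: "('g, 'e::euclidean_space) lie_group \<Rightarrow>
    ('g \<Rightarrow> 'g tens2) \<Rightarrow> 'g tens2 \<Rightarrow> bool" where
  "quasitriangular_structure G \<omega> r \<longleftrightarrow>
     set r \<subseteq> lie_algebra G \<times> lie_algebra G \<and>
     tensor3 (cybe_tensor G r) = (\<lambda>a b c. 0) \<and>
     (\<forall>v\<in>lie_algebra G. cobracket \<omega> v = tensor2 (ad_tensor G v r))"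


section \<open>Preconnections\<close>

definition preconnection :: "('g, 'e::euclidean_space) lie_group \<Rightarrow> ('g \<Rightarrow> 'g tens2) \<Rightarrow>
    (('g \<Rightarrow> real) \<Rightarrow> 'g form \<Rightarrow> 'g form) \<Rightarrow> bool" where
  "preconnection G \<omega> \<gamma> \<longleftrightarrow>
     (\<forall>x\<in>C_inf G. \<forall>\<tau>\<in>one_forms G. \<gamma> x \<tau> \<in> one_forms G) \<and>
     (\<forall>x\<in>C_inf G. \<forall>y\<in>C_inf G. \<forall>\<tau>\<in>one_forms G.
        \<gamma> (\<lambda>g. x g + y g) \<tau> = (\<lambda>g u. \<gamma> x \<tau> g u + \<gamma> y \<tau> g u)) \<and>
     (\<forall>x\<in>C_inf G. \<forall>\<sigma>\<in>one_forms G. \<forall>\<tau>\<in>one_forms G.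
        \<gamma> x (\<lambda>g u. \<sigma> g u + \<tau> g u) = (\<lambda>g u. \<gamma> x \<sigma> g u + \<gamma> x \<tau> g u)) \<and>
     (\<forall>x\<in>C_inf G. \<forall>\<tau>\<in>one_forms G. \<forall>c.
        \<gamma> (\<lambda>g. c * x g) \<tau> = (\<lambda>g u. c * \<gamma> x \<tau> g u) \<and>
        \<gamma> x (\<lambda>g u. c * \<tau> g u) = (\<lambda>g u. c * \<gamma> x \<tau> g u)) \<and>
     (\<forall>x\<in>C_inf G. \<forall>y\<in>C_inf G. \<forall>\<tau>\<in>one_forms G.
        \<gamma> (\<lambda>g. x g * y g) \<tau> = (\<lambda>g u. x g * \<gamma> y \<tau> g u + \<gamma> x \<tau> g u * y g)) \<and>
     (\<forall>x\<in>C_inf G. \<forall>y\<in>C_inf G. \<forall>\<tau>\<in>one_forms G.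
        \<gamma> x (\<lambda>g u. \<tau> g u * y g) =
          (\<lambda>g u. \<gamma> x \<tau> g u * y g + \<tau> g u * poisson_bracket \<omega> x y g))"

definition compatible :: "('g, 'e::euclidean_space) lie_group \<Rightarrow> ('g \<Rightarrow> 'g tens2) \<Rightarrow>
    (('g \<Rightarrow> real) \<Rightarrow> 'g form \<Rightarrow> 'g form) \<Rightarrow> bool" where
  "compatible G \<omega> \<gamma> \<longleftrightarrow> (\<forall>x\<in>C_inf G. \<forall>y\<in>C_inf G.
     differential G (poisson_bracket \<omega> x y) =
       (\<lambda>g u. \<gamma> x (differential G y) g u - \<gamma> y (differential G x) g u))"

definition bilinear_on_dual :: "('g, 'e::euclidean_space) lie_group \<Rightarrow>
    (('g tvec \<Rightarrow> real) \<Rightarrow> ('g tvec \<Rightarrow> real) \<Rightarrow> ('g tvec \<Rightarrow> real)) \<Rightarrow> bool" where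
  "bilinear_on_dual G \<Xi> \<longleftrightarrow> (\<forall>\<phi>\<in>lie_dual G. \<forall>\<psi>\<in>lie_dual G.
     \<Xi> \<phi> \<psi> \<in> lie_dual G \<and>
     (\<forall>\<theta>\<in>lie_dual G.
        \<Xi> (\<lambda>v. \<phi> v + \<theta> v) \<psi> = (\<lambda>w. \<Xi> \<phi> \<psi> w + \<Xi> \<theta> \<psi> w) \<and>
        \<Xi> \<phi> (\<lambda>v. \<psi> v + \<theta> v) = (\<lambda>w. \<Xi> \<phi> \<psi> w + \<Xi> \<phi> \<theta> w)) \<and>
     (\<forall>c. \<Xi> (\<lambda>v. c * \<phi> v) \<psi> = (\<lambda>w. c * \<Xi> \<phi> \<psi> w) \<and>
          \<Xi> \<phi> (\<lambda>v. c * \<psi> v) = (\<lambda>w. c * \<Xi> \<phi> \<psi> w)))"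

text \<open>The Poisson bracket of a function with a function valued in the dual of the Lie algebra is
  formed by evaluating the latter at each \<open>v\<close>.\<close>

definition dual_bracket :: "('g \<Rightarrow> 'g tens2) \<Rightarrow> ('g \<Rightarrow> real) \<Rightarrow>
    ('g \<Rightarrow> 'g tvec \<Rightarrow> real) \<Rightarrow> ('g \<Rightarrow> 'g tvec \<Rightarrow> real)" where
  "dual_bracket \<omega> a s = (\<lambda>g v. poisson_bracket \<omega> a (\<lambda>h. s h v) g)"

definition left_invariant_preconnection :: "('g, 'e::euclidean_space) lie_group \<Rightarrow>
    ('g \<Rightarrow> 'g tens2) \<Rightarrow> (('g \<Rightarrow> real) \<Rightarrow> 'g form \<Rightarrow> 'g form) \<Rightarrow>
    (('g tvec \<Rightarrow> real) \<Rightarrow> ('g tvec \<Rightarrow> real) \<Rightarrow> ('g tvec \<Rightarrow> real)) \<Rightarrow> bool" where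
  "left_invariant_preconnection G \<omega> \<gamma> \<Xi> \<longleftrightarrow>
     preconnection G \<omega> \<gamma> \<and> bilinear_on_dual G \<Xi> \<and>
     (\<forall>a\<in>C_inf G. \<forall>\<tau>\<in>one_forms G. \<forall>g.
        tilde G (\<gamma> a \<tau>) g =
          (\<lambda>v. dual_bracket \<omega> a (tilde G \<tau>) g v + \<Xi> (Lhat G a g) (tilde G \<tau> g) v))"

definition Xi_hat :: "('g, 'e::euclidean_space) lie_group \<Rightarrow> 'g tens2 \<Rightarrow>
    (('g tvec \<Rightarrow> real) \<Rightarrow> ('g tvec \<Rightarrow> real) \<Rightarrow> ('g tvec \<Rightarrow> real)) \<Rightarrow>
    (('g tvec \<Rightarrow> real) \<Rightarrow> ('g tvec \<Rightarrow> real) \<Rightarrow> ('g tvec \<Rightarrow> real))" where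
  "Xi_hat G r \<Xi> \<phi> \<psi> = (\<lambda>w. \<Xi> \<phi> \<psi> w - (\<Sum>(p, q)\<leftarrow>r_minus r. \<phi> p * coadjoint G q \<psi> w))"

end

theory Submission
  imports Defs
begin

text \<open>
  Fix smooth functions \<open>a\<close>, \<open>b\<close>, a point \<open>g\<close> and \<open>v\<close> in the Lie algebra, and let \<open>v\<^sup>L\<close> be the left invariant
  vector field \<open>g \<mapsto> g v\<close>. By definition of \<open>\<Xi>\<close>, the compatibility condition evaluated on \<open>g v\<close> reads
  \<open>v\<^sup>L {a, b} = {a, v\<^sup>L b} - {b, v\<^sup>L a} + \<Xi> (L\<^sub>a, L\<^sub>b) v - \<Xi> (L\<^sub>b, L\<^sub>a) v\<close>. Multiplicativity of the Poisson bivector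
  says that \<open>v\<^sup>L\<close> differentiates the bracket up to the cobracket,
  \<open>v\<^sup>L {a, b} = {v\<^sup>L a, b} + {a, v\<^sup>L b} + \<delta> v (a \<circ> L\<^sub>g, b \<circ> L\<^sub>g)\<close>
  (\<open>multiplicative_bracket_derivative\<close>). The brackets cancel, and compatibility becomes the purely algebraic
  statement that \<open>\<delta> v\<close> is the antisymmetrisation of \<open>\<Xi>\<close> evaluated at \<open>v\<close>, on all pairs of differentials at the
  identity (\<open>compatible_iff_cobracket\<close>). In the quasitriangular case \<open>\<delta> v = ad\<^sub>v r\<close> is antisymmetric, hence equal
  to \<open>ad\<^sub>v r\<^sub>-\<close>, and this is the antisymmetrisation of the bilinear map subtracted in the definition of
  \<open>Xi_hat\<close> (\<open>cobracket_r_minus\<close>). So the condition says precisely that \<open>Xi_hat\<close> is symmetric, provided that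
  every element of the dual of the Lie algebra is the differential of a smooth function
  (\<open>cotangent_is_differential\<close>).

  Two facts about tangent vectors, which are derivations of the algebra of global smooth functions, carry the
  analysis. First, they are directional derivatives in charts (\<open>tangent_vector_in_chart\<close>), which follows from
  Hadamard's lemma and bump functions. Second, tangent vectors acting on the two variables of a smooth function
  on the product of the group with itself commute (\<open>partial_derivatives_commute\<close>), which is the symmetry of
  second derivatives. The second fact is applied to the functions \<open>(x, h) \<mapsto> a (x h)\<close> and yields the
  Leibniz rule above.
\<close>

section \<open>Calculus of smooth maps\<close>

lemma Ck_on_subset: "Ck_on k S f \<Longrightarrow> T \<subseteq> S \<Longrightarrow> Ck_on k T f"
  by (induction k arbitrary: f) (auto intro: continuous_on_subset)

lemma Ck_on_SucD: "Ck_on (Suc k) S f \<Longrightarrow> Ck_on k S f"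
proof (induction k arbitrary: f)
  case 0
  then show ?case
    by (simp add: differentiable_at_imp_differentiable_on differentiable_imp_continuous_on)
next
  case (Suc k)
  then show ?case by (metis Ck_on.simps(2))
qed

lemma Ck_on_continuous: "Ck_on k S f \<Longrightarrow> continuous_on S f"
  by (induction k) (simp, blast dest: Ck_on_SucD)

text \<open>Differentiability at a point sees only a neighbourhood of it, so all gluing of smooth functions along
  open covers (zero extensions, compositions read in several charts) goes through this lemma.\<close>

lemma Ck_on_local:
  assumes "\<And>x. x \<in> S \<Longrightarrow> \<exists>T. open T \<and> x \<in> T \<and> Ck_on k T f"
  shows "Ck_on k S f"
  using assms
proof (induction k arbitrary: f)
  case 0
  have "isCont f x" if x: "x \<in> S" for x
  proof -
    obtain T where "open T" "x \<in> T" "continuous_on T f"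
      using 0[OF x] unfolding Ck_on.simps by blast
    then show ?thesis using continuous_on_eq_continuous_at by blast
  qed
  then show ?case by (simp add: continuous_at_imp_continuous_on)
next
  case (Suc k)
  have "f differentiable (at x)" if x: "x \<in> S" for x
    using Suc.prems[OF x] by auto
  moreover have "Ck_on k S (\<lambda>x. frechet_derivative f (at x) w)" for w
  proof (rule Suc.IH)
    fix x assume "x \<in> S"
    then show "\<exists>T. open T \<and> x \<in> T \<and> Ck_on k T (\<lambda>x. frechet_derivative f (at x) w)"
      using Suc.prems unfolding Ck_on.simps by blast
  qed
  ultimately show ?case by simp
qed

lemma Ck_on_cong:
  assumes "open S" "\<And>x. x \<in> S \<Longrightarrow> f x = g x" "Ck_on k S f"
  shows "Ck_on k S g"
  using assms(2,3)
proof (induction k arbitrary: f g)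
  case 0
  then show ?case using continuous_on_cong by (metis Ck_on.simps(1))
next
  case (Suc k)
  have d: "f differentiable (at x)" if "x \<in> S" for x
    using Suc.prems that by auto
  have eq: "frechet_derivative f (at x) = frechet_derivative g (at x)" if x: "x \<in> S" for x
    by (rule frechet_derivative_transform_within_open[OF d[OF x] assms(1) x Suc.prems(1)])
  have "g differentiable (at x)" if x: "x \<in> S" for x
  proof -
    have "(f has_derivative frechet_derivative f (at x)) (at x)"
      using d[OF x] frechet_derivative_works by blast
    from has_derivative_transform_within_open[OF this assms(1) x Suc.prems(1)]
    show ?thesis by (auto simp: differentiable_def)
  qed
  moreover have "Ck_on k S (\<lambda>x. frechet_derivative g (at x) w)" for w
  proof (rule Suc.IH)
    show "Ck_on k S (\<lambda>x. frechet_derivative f (at x) w)"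
      using Suc.prems(2) by simp
  qed (simp add: eq)
  ultimately show ?case by simp
qed

text \<open>The derivatives in the definition of \<open>Ck_on\<close> are chosen by a description operator. On open sets they
  are unique, so an explicitly computed derivative may be used instead.\<close>

lemma Ck_on_SucI:
  assumes "open S" "\<And>x. x \<in> S \<Longrightarrow> (f has_derivative f' x) (at x)"
    and "\<And>w. Ck_on k S (\<lambda>x. f' x w)"
  shows "Ck_on (Suc k) S f"
proof -
  have "f' x = frechet_derivative f (at x)" if "x \<in> S" for x
    using frechet_derivative_at assms(2) that by blast
  then have "Ck_on k S (\<lambda>x. frechet_derivative f (at x) w)" for w
    using Ck_on_cong[OF assms(1) _ assms(3)[of w]] by simp
  then show ?thesis using assms(2) by (auto simp: differentiable_def)
qed

lemma Ck_on_SucE: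
  assumes "Ck_on (Suc k) S f"
  shows "\<And>x. x \<in> S \<Longrightarrow> (f has_derivative frechet_derivative f (at x)) (at x)"
    and "\<And>w. Ck_on k S (\<lambda>x. frechet_derivative f (at x) w)"
  using assms frechet_derivative_works by auto

lemma Ck_on_const: "open S \<Longrightarrow> Ck_on k S (\<lambda>x. c)"
proof (induction k arbitrary: c)
  case (Suc k)
  show ?case by (rule Ck_on_SucI[OF Suc.prems, where f' = "\<lambda>_ _. 0"]) (auto intro: Suc)
qed auto

lemma Ck_on_linear: "open S \<Longrightarrow> bounded_linear f \<Longrightarrow> Ck_on k S f"
proof (cases k)
  case 0
  then show "bounded_linear f \<Longrightarrow> ?thesis" by (simp add: linear_continuous_on)
next
  case (Suc j)
  assume "open S" "bounded_linear f"
  then have "Ck_on (Suc j) S f"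
    by (intro Ck_on_SucI[where f' = "\<lambda>_. f"] bounded_linear_imp_has_derivative Ck_on_const) 
  with Suc show ?thesis by simp
qed

lemma Ck_on_add:
  assumes "open S"
  shows "Ck_on k S f \<Longrightarrow> Ck_on k S g \<Longrightarrow> Ck_on k S (\<lambda>x. f x + g x)"
proof (induction k arbitrary: f g)
  case 0
  then show ?case by (auto intro: continuous_intros)
next
  case (Suc k)
  show ?case
    by (rule Ck_on_SucI[OF assms has_derivative_add[OF Ck_on_SucE(1)[OF Suc.prems(1)] Ck_on_SucE(1)[OF Suc.prems(2)]]])
       (assumption | intro Suc.IH Suc.prems[THEN Ck_on_SucE(2)])+
qed

lemma Ck_on_mult:
  fixes f g :: "'a::real_normed_vector \<Rightarrow> real"
  assumes "open S"
  shows "Ck_on k S f \<Longrightarrow> Ck_on k S g \<Longrightarrow> Ck_on k S (\<lambda>x. f x * g x)"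
proof (induction k arbitrary: f g)
  case 0
  then show ?case by (auto intro: continuous_intros)
next
  case (Suc k)
  show ?case
    by (rule Ck_on_SucI[OF assms has_derivative_mult[OF Ck_on_SucE(1)[OF Suc.prems(1)] Ck_on_SucE(1)[OF Suc.prems(2)]]])
       (assumption | intro Ck_on_add[OF assms] Suc.IH Suc.prems[THEN Ck_on_SucE(2)] Suc.prems[THEN Ck_on_SucD])+
qed

lemma Ck_on_sum:
  assumes "open S" "\<And>i. i \<in> I \<Longrightarrow> Ck_on k S (f i)"
  shows "Ck_on k S (\<lambda>x. \<Sum>i\<in>I. f i x)"
  using assms(2)
  by (induction I rule: infinite_finite_induct) (auto intro: Ck_on_const Ck_on_add assms(1))

lemma Ck_on_linear_compose:
  assumes "open S" "bounded_linear h"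
  shows "Ck_on k S f \<Longrightarrow> Ck_on k S (\<lambda>x. h (f x))"
proof (induction k arbitrary: f)
  case 0
  then show ?case by (auto intro: bounded_linear.continuous_on[OF assms(2)])
next
  case (Suc k)
  show ?case
    by (rule Ck_on_SucI[OF assms(1) bounded_linear.has_derivative[OF assms(2) Ck_on_SucE(1)[OF Suc.prems]]])
       (assumption | intro Suc.IH Suc.prems[THEN Ck_on_SucE(2)])+
qed

lemma linear_Basis_expansion:
  fixes h :: "'a::euclidean_space \<Rightarrow> real"
  assumes "linear h"
  shows "h y = (\<Sum>b\<in>Basis. (y \<bullet> b) * h b)"
proof -
  have "(\<Sum>b\<in>Basis. (y \<bullet> b) * h b) = h (\<Sum>b\<in>Basis. (y \<bullet> b) *\<^sub>R b)"
    unfolding linear_sum[OF assms] linear_cmul[OF assms] by simp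
  then show ?thesis by (simp only: euclidean_representation)
qed

text \<open>The chain rule expresses the derivative of the composite through the products
  \<open>(D\<^sub>w f \<bullet> b) * (\<partial>\<^sub>b g \<circ> f)\<close>, whose second factor is again a composite with \<open>f\<close>; the induction
  therefore varies \<open>g\<close> and keeps \<open>f\<close>.\<close>

lemma Ck_on_compose:
  fixes f :: "'a::real_normed_vector \<Rightarrow> 'b::euclidean_space" and g :: "'b \<Rightarrow> real"
  assumes "open S" "open T" "f ` S \<subseteq> T"
  shows "Ck_on k S f \<Longrightarrow> Ck_on k T g \<Longrightarrow> Ck_on k S (\<lambda>x. g (f x))"
proof (induction k arbitrary: g)
  case 0
  then show ?case using assms by (auto intro: continuous_on_compose2)
next
  case (Suc k)
  let ?f = "\<lambda>x. frechet_derivative f (at x)" and ?g = "\<lambda>x. frechet_derivative g (at x)"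
  have "((\<lambda>x. g (f x)) has_derivative (\<lambda>w. \<Sum>b\<in>Basis. (?f x w \<bullet> b) * ?g (f x) b)) (at x)"
    if x: "x \<in> S" for x
  proof -
    have gd: "(g has_derivative ?g (f x)) (at (f x))"
      using Ck_on_SucE(1)[OF Suc.prems(2)] assms(3) x by blast
    have "(\<lambda>w. ?g (f x) (?f x w)) = (\<lambda>w. \<Sum>b\<in>Basis. (?f x w \<bullet> b) * ?g (f x) b)"
      using linear_Basis_expansion[OF has_derivative_linear[OF gd]] by (intro ext)
    with has_derivative_compose[OF Ck_on_SucE(1)[OF Suc.prems(1) x] gd] show ?thesis
      by (rule back_subst)
  qed
  then show ?case
  proof (rule Ck_on_SucI[OF assms(1)])
    fix w
    show "Ck_on k S (\<lambda>x. \<Sum>b\<in>Basis. (?f x w \<bullet> b) * ?g (f x) b)"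
      by (intro Ck_on_sum Ck_on_mult assms Suc.IH Ck_on_SucE(2)[OF Suc.prems(2)]
         Ck_on_SucD[OF Suc.prems(1)]
         Ck_on_linear_compose[OF assms(1) bounded_linear_inner_left] Ck_on_SucE(2)[OF Suc.prems(1)])
  qed
qed

lemma segment_in_ball:
  fixes c :: "'a::real_normed_vector"
  assumes "x \<in> ball c r" "0 \<le> t" "t \<le> 1"
  shows "c + t *\<^sub>R (x - c) \<in> ball c r"
proof -
  have "norm (t *\<^sub>R (x - c)) \<le> 1 * norm (x - c)"
    unfolding norm_scaleR using assms by (intro mult_right_mono) auto
  then show ?thesis using assms(1) by (auto simp: dist_norm norm_minus_commute)
qed

lemma integral_along_rays_continuous:
  fixes f :: "'a::real_normed_vector \<Rightarrow> 'c::banach"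
  assumes "continuous_on (ball c r) f"
  shows "continuous_on (ball c r \<times> cbox 0 (1::real)) (\<lambda>(x,t). t ^ j *\<^sub>R f (c + t *\<^sub>R (x - c)))"
  unfolding split_beta
  by (intro continuous_intros continuous_on_compose2[OF assms])
     (use segment_in_ball in fastforce)

text \<open>Differentiating \<open>\<integral> t\<^sup>j f (c + t (x - c)) dt\<close> in the direction \<open>w\<close> gives the same kind of integral for
  \<open>D\<^sub>w f\<close> with one more power of \<open>t\<close>. The weight \<open>t\<^sup>j\<close> is there to make this induction close; only \<open>j = 0\<close>
  enters the lemma of Hadamard below.\<close>

lemma Ck_on_integral_along_rays:
  fixes f :: "'a::euclidean_space \<Rightarrow> real"
  assumes "Ck_on k (ball c r) f"
  shows "Ck_on k (ball c r) (\<lambda>x. integral {0..1} (\<lambda>t. t ^ j * f (c + t *\<^sub>R (x - c))))"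
  using assms
proof (induction k arbitrary: f j)
  case 0
  then have "continuous_on (ball c r) f" by simp
  from integral_continuous_on_param[OF integral_along_rays_continuous[OF this, of j]]
  show ?case by (simp add: cbox_interval)
next
  case (Suc k)
  let ?f = "\<lambda>x. frechet_derivative f (at x)"
  let ?B = "ball c r"
  \<comment> \<open>The derivative of the integrand as a bounded linear map, written in coordinates so that its joint
    continuity in \<open>(x, t)\<close> reduces to that of the partial derivatives.\<close>
  define fx where "fx x t = (\<Sum>b\<in>Basis. (t ^ Suc j * ?f (c + t *\<^sub>R (x - c)) b) *\<^sub>R blinfun_inner_left b)"
    for x t
  have lin: "linear (?f y)" if "y \<in> ?B" for y
    using Ck_on_SucE(1)[OF Suc.prems that] has_derivative_linear by blast
  have cont: "continuous_on ?B (\<lambda>x. ?f x w)" for w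
    using Ck_on_SucE(2)[OF Suc.prems] Ck_on_continuous by blast
  have fx_apply: "blinfun_apply (fx x t) w = t ^ Suc j * ?f (c + t *\<^sub>R (x - c)) w"
    if "x \<in> ?B" "t \<in> {0..1}" for x t w
  proof -
    have l: "linear (?f (c + t *\<^sub>R (x - c)))"
      using lin segment_in_ball that by force
    have "?f (c + t *\<^sub>R (x - c)) w = (\<Sum>b\<in>Basis. (w \<bullet> b) * ?f (c + t *\<^sub>R (x - c)) b)"
      by (rule linear_Basis_expansion[OF l])
    then show ?thesis
      by (simp add: fx_def blinfun.sum_left blinfun.scaleR_left sum_distrib_left mult_ac inner_commute)
  qed
  have cfx: "continuous_on (?B \<times> cbox 0 1) (\<lambda>(x,t). fx x t)"
  proof -
    have "continuous_on (?B \<times> cbox 0 1) (\<lambda>z. snd z ^ Suc j * ?f (c + snd z *\<^sub>R (fst z - c)) b)" for b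
      using integral_along_rays_continuous[OF cont[of b], of "Suc j"] by (simp add: split_beta)
    then show ?thesis unfolding fx_def split_beta
      by (intro continuous_on_sum continuous_on_scaleR continuous_on_const)
  qed
  have cf: "continuous_on ?B f" using Suc.prems Ck_on_continuous by blast
  have int: "(\<lambda>t. t ^ j * f (c + t *\<^sub>R (x - c))) integrable_on cbox 0 1" if "x \<in> ?B" for x
  proof -
    have "continuous_on (cbox 0 1) (\<lambda>t. t ^ j * f (c + t *\<^sub>R (x - c)))"
      by (intro continuous_intros continuous_on_compose2[OF cf])
         (use segment_in_ball that in fastforce)
    then show ?thesis by (rule integrable_continuous)
  qed
  have intfx: "fx x integrable_on cbox 0 1" if "x \<in> ?B" for x
  proof -
    have "continuous_on (cbox 0 1) (\<lambda>t. (\<lambda>(x, t). fx x t) (x, t))"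
      by (rule continuous_on_compose2[OF cfx]) (use that in \<open>auto intro!: continuous_intros\<close>)
    then show ?thesis by (intro integrable_continuous) simp
  qed
  have der: "((\<lambda>x. integral (cbox 0 1) (\<lambda>t. t ^ j * f (c + t *\<^sub>R (x - c)))) has_derivative
      blinfun_apply (integral (cbox 0 1) (fx x))) (at x)" if x: "x \<in> ?B" for x
  proof -
    have "((\<lambda>x. integral (cbox 0 1) (\<lambda>t. t ^ j * f (c + t *\<^sub>R (x - c)))) has_derivative
      blinfun_apply (integral (cbox 0 1) (fx x))) (at x within ?B)"
    proof (rule leibniz_rule[OF _ int cfx x convex_ball])
      fix y and t :: real assume yt: "y \<in> ?B" "t \<in> cbox 0 1"
      have seg: "c + t *\<^sub>R (y - c) \<in> ?B" using yt segment_in_ball by force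
      have "((\<lambda>x. c + t *\<^sub>R (x - c)) has_derivative (\<lambda>w. t *\<^sub>R w)) (at y)"
        by (auto intro!: derivative_eq_intros)
      from has_derivative_compose[OF this Ck_on_SucE(1)[OF Suc.prems seg]]
      have "((\<lambda>x. t ^ j * f (c + t *\<^sub>R (x - c))) has_derivative
          (\<lambda>w. t ^ j * ?f (c + t *\<^sub>R (y - c)) (t *\<^sub>R w))) (at y)"
        by (rule has_derivative_mult_right)
      also have "(\<lambda>w. t ^ j * ?f (c + t *\<^sub>R (y - c)) (t *\<^sub>R w)) = blinfun_apply (fx y t)"
        using yt fx_apply[of y t] linear_cmul[OF lin[OF seg]] by (auto simp: fun_eq_iff)
      finally show "((\<lambda>x. t ^ j * f (c + t *\<^sub>R (x - c))) has_derivative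
          blinfun_apply (fx y t)) (at y within ?B)" by (rule has_derivative_at_withinI)
    qed
    then show ?thesis using x by (simp add: at_within_open[OF x])
  qed
  have val: "blinfun_apply (integral (cbox 0 1) (fx x)) w =
      integral {0..1} (\<lambda>t. t ^ Suc j * ?f (c + t *\<^sub>R (x - c)) w)" if x: "x \<in> ?B" for x w
  proof -
    have "blinfun_apply (integral (cbox 0 1) (fx x)) w = integral (cbox 0 1) (\<lambda>t. blinfun_apply (fx x t) w)"
      using integral_linear[OF intfx[OF x] blinfun.bounded_linear_left] by (simp add: o_def)
    also have "\<dots> = integral {0..1} (\<lambda>t. t ^ Suc j * ?f (c + t *\<^sub>R (x - c)) w)"
      unfolding cbox_interval by (rule integral_cong) (use x fx_apply in auto)
    finally show ?thesis .
  qed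
  show ?case
    unfolding cbox_interval[symmetric]
  proof (rule Ck_on_SucI[OF open_ball der])
    fix w
    show "Ck_on k ?B (\<lambda>x. blinfun_apply (integral (cbox 0 1) (fx x)) w)"
      by (rule Ck_on_cong[OF open_ball _ Suc.IH[OF Ck_on_SucE(2)[OF Suc.prems], of "Suc j" w]])
         (simp only: val)
  qed
qed

lemma smooth_on_subset: "smooth_on S f \<Longrightarrow> T \<subseteq> S \<Longrightarrow> smooth_on T f"
  unfolding smooth_on_def using Ck_on_subset by blast

lemma smooth_on_local:
  assumes "\<And>x. x \<in> S \<Longrightarrow> \<exists>T. open T \<and> x \<in> T \<and> smooth_on T f"
  shows "smooth_on S f"
  unfolding smooth_on_def
proof
  fix k
  show "Ck_on k S f" by (rule Ck_on_local) (meson assms smooth_on_def)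
qed

lemma smooth_on_cong:
  "open S \<Longrightarrow> (\<And>x. x \<in> S \<Longrightarrow> f x = g x) \<Longrightarrow> smooth_on S f \<Longrightarrow> smooth_on S g"
  unfolding smooth_on_def by (meson Ck_on_cong)

lemma smooth_on_const: "open S \<Longrightarrow> smooth_on S (\<lambda>x. c)"
  by (simp add: smooth_on_def Ck_on_const)

lemma smooth_on_linear: "open S \<Longrightarrow> bounded_linear f \<Longrightarrow> smooth_on S f"
  by (simp add: smooth_on_def Ck_on_linear)

lemma smooth_on_add: "open S \<Longrightarrow> smooth_on S f \<Longrightarrow> smooth_on S g \<Longrightarrow> smooth_on S (\<lambda>x. f x + g x)"
  by (simp add: smooth_on_def Ck_on_add)

lemma smooth_on_mult:
  fixes f g :: "'a::real_normed_vector \<Rightarrow> real"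
  shows "open S \<Longrightarrow> smooth_on S f \<Longrightarrow> smooth_on S g \<Longrightarrow> smooth_on S (\<lambda>x. f x * g x)"
  by (simp add: smooth_on_def Ck_on_mult)

lemma smooth_on_sum:
  "open S \<Longrightarrow> (\<And>i. i \<in> I \<Longrightarrow> smooth_on S (f i)) \<Longrightarrow> smooth_on S (\<lambda>x. \<Sum>i\<in>I. f i x)"
  by (simp add: smooth_on_def Ck_on_sum)

lemma smooth_on_compose:
  fixes f :: "'a::real_normed_vector \<Rightarrow> 'b::euclidean_space" and g :: "'b \<Rightarrow> real"
  assumes "open S" "open T" "f ` S \<subseteq> T" "smooth_on S f" "smooth_on T g"
  shows "smooth_on S (\<lambda>x. g (f x))"
  using assms Ck_on_compose[OF assms(1-3)] by (auto simp: smooth_on_def)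

lemma smooth_on_has_derivative:
  "smooth_on S f \<Longrightarrow> x \<in> S \<Longrightarrow> (f has_derivative frechet_derivative f (at x)) (at x)"
  unfolding smooth_on_def by (meson Ck_on_SucE(1))

lemma smooth_on_frechet_derivative:
  "smooth_on S f \<Longrightarrow> smooth_on S (\<lambda>x. frechet_derivative f (at x) w)"
  unfolding smooth_on_def by (blast intro: Ck_on_SucE(2))

lemma smooth_on_continuous: "smooth_on S f \<Longrightarrow> continuous_on S f"
  unfolding smooth_on_def by (meson Ck_on_continuous)

lemma linear_frechet_derivative_smooth:
  "smooth_on S f \<Longrightarrow> x \<in> S \<Longrightarrow> linear (frechet_derivative f (at x))"
  using smooth_on_has_derivative has_derivative_linear by blast

lemma smooth_on_inner_shift: "smooth_on UNIV (\<lambda>x::'a::euclidean_space. (x - c) \<bullet> b)"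
proof -
  have "smooth_on UNIV (\<lambda>x::'a. x \<bullet> b + - (c \<bullet> b))"
    by (intro smooth_on_add smooth_on_const smooth_on_linear open_UNIV bounded_linear_inner_left)
  then show ?thesis by (simp add: inner_diff_left)
qed

lemma smooth_on_Pair_left:
  "smooth_on UNIV (\<lambda>y::'b::real_normed_vector. (c::'a::real_normed_vector, y))"
proof -
  have "smooth_on UNIV (\<lambda>y::'b. (c, 0) + (0::'a, y))"
    by (intro smooth_on_add smooth_on_const smooth_on_linear open_UNIV bounded_linear_Pair 
        bounded_linear_zero bounded_linear_ident)
  then show ?thesis by simp
qed

section \<open>Bump functions\<close>

text \<open>These functions are closed under differentiation up to linear combinations, which makes the smoothness
  of \<open>flat 0\<close>, the usual flat function \<open>exp (- 1 / t)\<close>, a plain induction.\<close>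

definition flat :: "nat \<Rightarrow> real \<Rightarrow> real" where
  "flat n t = (if t \<le> 0 then 0 else exp (- (1/t)) / t ^ n)"

text \<open>With \<open>u = 1 / t\<close> this is the decay of \<open>u ^ n * exp (- u)\<close> at infinity.\<close>

lemma flat_tendsto_0: "(flat n \<longlongrightarrow> 0) (at 0)"
proof -
  have "((\<lambda>t::real. inverse t ^ n / exp (inverse t)) \<longlongrightarrow> 0) (at_right 0)"
    by (rule filterlim_compose[OF tendsto_power_div_exp_0 filterlim_inverse_at_top_right])
  moreover have "eventually (\<lambda>t. inverse t ^ n / exp (inverse t) = flat n t) (at_right 0)"
    by (auto simp: eventually_at_filter flat_def exp_minus field_simps intro!: always_eventually)
  ultimately have "(flat n \<longlongrightarrow> 0) (at_right 0)"
    by (rule Lim_transform_eventually)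
  moreover have "(flat n \<longlongrightarrow> 0) (at_left 0)"
    by (rule Lim_transform_eventually[OF tendsto_const])
       (auto simp: eventually_at_filter flat_def)
  ultimately show ?thesis by (rule filterlim_split_at[rotated])
qed

lemma flat_has_derivative:
  "(flat n has_real_derivative (flat (n + 2) t - real n * flat (Suc n) t)) (at t)"
proof -
  consider "t < 0" | "t = 0" | "t > 0" by linarith
  then show ?thesis
  proof cases
    case 1
    have "((\<lambda>t. 0) has_real_derivative 0) (at t)" by simp
    then have "(flat n has_real_derivative 0) (at t)"
      by (rule has_field_derivative_transform_within_open[of _ _ _ "{..<0}"]) (use 1 in \<open>auto simp: flat_def\<close>)
    with 1 show ?thesis by (simp add: flat_def)
  next
    case 2
    have "(flat n h - flat n 0) / h = flat (Suc n) h" for h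
      by (simp add: flat_def)
    then have "(flat n has_real_derivative 0) (at 0)"
      using flat_tendsto_0[of "Suc n"] by (simp add: has_field_derivative_iff)
    with 2 show ?thesis by (simp add: flat_def)
  next
    case 3
    have "((\<lambda>t. exp (- (1/t)) / t ^ n) has_real_derivative
        (flat (n + 2) t - real n * flat (Suc n) t)) (at t)"
      using 3
      by (auto intro!: derivative_eq_intros simp: flat_def field_simps)
         (cases n; simp add: field_simps power2_eq_square)
    then show ?thesis
      by (rule has_field_derivative_transform_within_open[of _ _ _ "{0<..}"]) (use 3 in \<open>auto simp: flat_def\<close>)
  qed
qed

lemma smooth_on_flat: "smooth_on UNIV (flat n)"
  unfolding smooth_on_def
proof
  fix k
  show "Ck_on k UNIV (flat n)"
  proof (induction k arbitrary: n)
    case 0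
    show ?case
      using flat_has_derivative by (auto intro!: continuous_at_imp_continuous_on DERIV_isCont)
  next
    case (Suc k)
    show ?case
    proof (rule Ck_on_SucI[OF open_UNIV])
      show "(flat n has_derivative (\<lambda>w. (flat (n + 2) t + - real n * flat (Suc n) t) * w)) (at t)" for t
        using flat_has_derivative[of n t] by (simp add: has_field_derivative_def)
      show "Ck_on k UNIV (\<lambda>t. (flat (n + 2) t + - real n * flat (Suc n) t) * w)" for w
        by (intro Ck_on_mult Ck_on_add Ck_on_const Suc.IH open_UNIV)
    qed
  qed
qed

lemma smooth_bump:
  fixes c :: "'a::euclidean_space"
  assumes "0 < r"
  obtains \<rho> :: "'a \<Rightarrow> real" where "smooth_on UNIV \<rho>" "\<rho> c = 1" "\<And>x. x \<notin> ball c r \<Longrightarrow> \<rho> x = 0"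
proof
  let ?q = "\<lambda>x. r\<^sup>2 + - 1 * (\<Sum>b\<in>Basis. ((x - c) \<bullet> b) * ((x - c) \<bullet> b))"
  let ?\<rho> = "\<lambda>x. flat 0 (?q x) * (1 / flat 0 (r\<^sup>2))"
  have q: "?q x = r\<^sup>2 - (dist c x)\<^sup>2" for x
    unfolding dist_commute[of c] by (simp add: dist_norm power2_norm_eq_inner flip: euclidean_inner)
  have "smooth_on UNIV ?q"
    by (intro smooth_on_add smooth_on_mult smooth_on_const smooth_on_sum smooth_on_inner_shift open_UNIV)
  then show "smooth_on UNIV ?\<rho>"
    by (intro smooth_on_mult smooth_on_const open_UNIV
        smooth_on_compose[OF open_UNIV open_UNIV _ _ smooth_on_flat]) auto
  show "?\<rho> c = 1" using assms by (simp add: flat_def)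
  show "?\<rho> x = 0" if "x \<notin> ball c r" for x
  proof -
    have "r\<^sup>2 \<le> (dist c x)\<^sup>2" using that assms by (intro power_mono) auto
    then show ?thesis unfolding q by (simp add: flat_def)
  qed
qed

section \<open>Hadamard's lemma and the symmetry of second derivatives\<close>

text \<open>Integrate the derivative of \<open>f\<close> along the segment from \<open>c\<close> to \<open>x\<close>. The point of this form of the
  first-order Taylor formula is that the coefficients \<open>g b\<close> are smooth: a derivation at \<open>c\<close> can then be
  applied to each product on the right, and only the values \<open>g b c\<close> survive.\<close>

lemma hadamard_lemma:
  fixes f :: "'a::euclidean_space \<Rightarrow> real"
  assumes f: "smooth_on (ball c r) f" and r: "0 < r"
  shows "\<exists>g. (\<forall>b. smooth_on (ball c r) (g b)) \<and> (\<forall>b. g b c = frechet_derivative f (at c) b) \<and>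
    (\<forall>x\<in>ball c r. f x = f c + (\<Sum>b\<in>Basis. ((x - c) \<bullet> b) * g b x))"
proof (intro exI conjI allI ballI)
  let ?D = "\<lambda>x. frechet_derivative f (at x)"
  let ?g = "\<lambda>b x. integral {0..1} (\<lambda>t. t ^ 0 * ?D (c + t *\<^sub>R (x - c)) b)"
  show "smooth_on (ball c r) (?g b)" for b
    using smooth_on_frechet_derivative[OF f, of b] Ck_on_integral_along_rays
    unfolding smooth_on_def by blast
  show "?g b c = ?D c b" for b by simp
  fix x assume x: "x \<in> ball c r"
  show "f x = f c + (\<Sum>b\<in>Basis. ((x - c) \<bullet> b) * ?g b x)"
  proof -
    have seg: "c + t *\<^sub>R (x - c) \<in> ball c r" if "t \<in> {0..1}" for t
      using segment_in_ball[OF x] that by simp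
    have "((\<lambda>t. f (c + t *\<^sub>R (x - c))) has_vector_derivative ?D (c + t *\<^sub>R (x - c)) (x - c))
        (at t within {0..1})" if t: "t \<in> {0..1}" for t
    proof -
      have "((\<lambda>t. c + t *\<^sub>R (x - c)) has_derivative (\<lambda>s. s *\<^sub>R (x - c))) (at t)"
        by (auto intro!: derivative_eq_intros)
      from has_derivative_compose[OF this smooth_on_has_derivative[OF f seg[OF t]]]
      show ?thesis
        using linear_cmul[OF linear_frechet_derivative_smooth[OF f seg[OF t]]]
        by (simp add: has_vector_derivative_def has_derivative_at_withinI)
    qed
    then have "((\<lambda>t. ?D (c + t *\<^sub>R (x - c)) (x - c)) has_integral
        f (c + 1 *\<^sub>R (x - c)) - f (c + 0 *\<^sub>R (x - c))) {0..1}"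
      by (intro fundamental_theorem_of_calculus) auto
    then have "f x - f c = integral {0..1} (\<lambda>t. ?D (c + t *\<^sub>R (x - c)) (x - c))"
      by (simp add: integral_unique)
    also have "\<dots> = integral {0..1} (\<lambda>t. \<Sum>b\<in>Basis. ((x - c) \<bullet> b) * ?D (c + t *\<^sub>R (x - c)) b)"
      by (rule integral_cong)
         (rule linear_Basis_expansion[OF linear_frechet_derivative_smooth[OF f seg]])
    also have "\<dots> = (\<Sum>b\<in>Basis. integral {0..1} (\<lambda>t. ((x - c) \<bullet> b) * ?D (c + t *\<^sub>R (x - c)) b))"
    proof (rule integral_sum)
      fix b :: 'a
      have "continuous_on {0..1} (\<lambda>t. ((x - c) \<bullet> b) * ?D (c + t *\<^sub>R (x - c)) b)"
        by (intro continuous_on_mult_left continuous_on_compose2[OF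
            smooth_on_continuous[OF smooth_on_frechet_derivative[OF f]]] continuous_intros)
           (use seg in auto)
      then show "(\<lambda>t. ((x - c) \<bullet> b) * ?D (c + t *\<^sub>R (x - c)) b) integrable_on {0..1}"
        by (rule integrable_continuous_interval)
    qed simp
    finally show ?thesis by simp
  qed
qed

text \<open>Two applications of the mean value theorem, first along \<open>u\<close> and then along \<open>w\<close>. The second difference
  on the left is symmetric in \<open>u\<close> and \<open>w\<close>, the right hand side is not obviously so; this asymmetry is
  what proves the next lemma.\<close>

lemma second_difference_mean_value:
  fixes f :: "'a::real_normed_vector \<Rightarrow> real"
  assumes f: "smooth_on S f" and e: "0 < e"
    and S: "\<And>s t. s \<in> {0..e} \<Longrightarrow> t \<in> {0..e} \<Longrightarrow> c + s *\<^sub>R u + t *\<^sub>R w \<in> S"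
  obtains s t where "s \<in> {0..e}" "t \<in> {0..e}"
    "f (c + e *\<^sub>R u + e *\<^sub>R w) - f (c + e *\<^sub>R u) - f (c + e *\<^sub>R w) + f c = e * e *
      frechet_derivative (\<lambda>x. frechet_derivative f (at x) u) (at (c + s *\<^sub>R u + t *\<^sub>R w)) w"
proof -
  let ?D = "\<lambda>x. frechet_derivative f (at x)"
  let ?D2 = "\<lambda>x. frechet_derivative (\<lambda>x. ?D x u) (at x)"
  have f': "smooth_on S (\<lambda>x. ?D x u)" by (rule smooth_on_frechet_derivative[OF f])
  let ?k = "\<lambda>s. f (c + s *\<^sub>R u + e *\<^sub>R w) - f (c + s *\<^sub>R u + 0 *\<^sub>R w)"
  have dk: "((\<lambda>s. f (c + s *\<^sub>R u + t *\<^sub>R w)) has_real_derivative ?D (c + s *\<^sub>R u + t *\<^sub>R w) u) (at s)"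
    if "s \<in> {0..e}" "t \<in> {0..e}" for s t
  proof -
    have "((\<lambda>s. c + s *\<^sub>R u + t *\<^sub>R w) has_derivative (\<lambda>h. h *\<^sub>R u)) (at s)"
      by (auto intro!: derivative_eq_intros)
    from has_derivative_compose[OF this smooth_on_has_derivative[OF f S[OF that]]]
    show ?thesis
      using linear_cmul[OF linear_frechet_derivative_smooth[OF f S[OF that]]]
      by (simp add: has_field_derivative_def mult.commute[of _ "?D _ _"])
  qed
  have "\<exists>s::real. s > 0 \<and> s < e \<and> ?k e - ?k 0 =
      (e - 0) * (?D (c + s *\<^sub>R u + e *\<^sub>R w) u - ?D (c + s *\<^sub>R u + 0 *\<^sub>R w) u)"
    by (rule MVT2) (use e in \<open>auto intro!: DERIV_diff dk simp del: scaleR_zero_left\<close>)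
  then obtain s where s: "s \<in> {0..e}" "?k e - ?k 0 =
      e * (?D (c + s *\<^sub>R u + e *\<^sub>R w) u - ?D (c + s *\<^sub>R u + 0 *\<^sub>R w) u)"
    unfolding atLeastAtMost_iff diff_0_right by (meson less_imp_le)
  have dl: "((\<lambda>t. ?D (c + s *\<^sub>R u + t *\<^sub>R w) u) has_real_derivative ?D2 (c + s *\<^sub>R u + t *\<^sub>R w) w) (at t)"
    if "t \<in> {0..e}" for t
  proof -
    have "((\<lambda>t. c + s *\<^sub>R u + t *\<^sub>R w) has_derivative (\<lambda>h. h *\<^sub>R w)) (at t)"
      by (auto intro!: derivative_eq_intros)
    from has_derivative_compose[OF this smooth_on_has_derivative[OF f' S[OF s(1) that]]]
    show ?thesis
      using linear_cmul[OF linear_frechet_derivative_smooth[OF f' S[OF s(1) that]]]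
      by (simp add: has_field_derivative_def mult.commute[of _ "?D2 _ _"])
  qed
  have "\<exists>t::real. t > 0 \<and> t < e \<and> ?D (c + s *\<^sub>R u + e *\<^sub>R w) u - ?D (c + s *\<^sub>R u + 0 *\<^sub>R w) u =
      (e - 0) * ?D2 (c + s *\<^sub>R u + t *\<^sub>R w) w"
    by (rule MVT2) (use e in \<open>auto intro!: dl\<close>)
  then obtain t where "t \<in> {0..e}" "?D (c + s *\<^sub>R u + e *\<^sub>R w) u - ?D (c + s *\<^sub>R u + 0 *\<^sub>R w) u =
      e * ?D2 (c + s *\<^sub>R u + t *\<^sub>R w) w"
    unfolding atLeastAtMost_iff diff_0_right by (meson less_imp_le)
  with s that show ?thesis by (simp add: algebra_simps)
qed

text \<open>Schwarz's theorem: both mixed derivatives are limits of the same second difference quotient.\<close>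

lemma frechet_derivative_commute:
  fixes f :: "'a::real_normed_vector \<Rightarrow> real"
  assumes S: "open S" "c \<in> S" and f: "smooth_on S f"
  shows "frechet_derivative (\<lambda>x. frechet_derivative f (at x) u) (at c) w =
         frechet_derivative (\<lambda>x. frechet_derivative f (at x) w) (at c) u" (is "?A c = ?B c")
proof (rule ccontr)
  assume ne: "?A c \<noteq> ?B c"
  define \<epsilon> where "\<epsilon> = dist (?A c) (?B c) / 2"
  have \<epsilon>: "\<epsilon> > 0" using ne by (simp add: \<epsilon>_def)
  have "smooth_on S ?A" "smooth_on S ?B"
    by (intro smooth_on_frechet_derivative f)+
  then have "continuous_on S ?A" "continuous_on S ?B"
    using smooth_on_continuous by blast+
  then have "isCont ?A c" "isCont ?B c"
    using continuous_on_eq_continuous_at[OF S(1)] S(2) by blast+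
  then obtain d1 d2 where d1: "d1 > 0" "\<And>x. dist x c < d1 \<Longrightarrow> dist (?A x) (?A c) < \<epsilon>"
    and d2: "d2 > 0" "\<And>x. dist x c < d2 \<Longrightarrow> dist (?B x) (?B c) < \<epsilon>"
    using \<epsilon> unfolding continuous_at_eps_delta by metis
  obtain d3 where d3: "d3 > 0" "ball c d3 \<subseteq> S" using S openE by blast
  define d where "d = min d1 (min d2 d3)"
  have d: "d > 0" using d1 d2 d3 by (simp add: d_def)
  \<comment> \<open>With this step the whole parallelogram spanned by \<open>e u\<close> and \<open>e w\<close> at \<open>c\<close> stays within distance \<open>d\<close>.\<close>
  define e where "e = d / (norm u + norm w + 1)"
  have pos: "norm u + norm w + 1 > 0" using norm_ge_zero[of u] norm_ge_zero[of w] by linarith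
  have e: "e > 0" using d pos by (simp add: e_def)
  have near: "dist (c + s *\<^sub>R u + t *\<^sub>R w) c < d" if "s \<in> {0..e}" "t \<in> {0..e}" for s t
  proof -
    have "dist (c + s *\<^sub>R u + t *\<^sub>R w) c = norm (s *\<^sub>R u + t *\<^sub>R w)" by (simp add: dist_norm)
    also have "\<dots> \<le> s * norm u + t * norm w"
      using norm_triangle_ineq[of "s *\<^sub>R u" "t *\<^sub>R w"] that by simp
    also have "\<dots> \<le> e * norm u + e * norm w"
      using that by (intro add_mono mult_right_mono) auto
    also have "\<dots> < e * (norm u + norm w + 1)" using e by (simp add: algebra_simps)
    also have "\<dots> = d" using pos by (simp add: e_def)
    finally show ?thesis .
  qed
  have inS: "c + s *\<^sub>R u + t *\<^sub>R w \<in> S" if "s \<in> {0..e}" "t \<in> {0..e}" for s t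
    using near[OF that] d3 by (force simp: d_def dist_commute)
  have inS': "c + s *\<^sub>R w + t *\<^sub>R u \<in> S" if "s \<in> {0..e}" "t \<in> {0..e}" for s t
    using inS[OF that(2,1)] by (simp add: algebra_simps)
  from second_difference_mean_value[OF f e inS] obtain s t where
    st: "s \<in> {0..e}" "t \<in> {0..e}" and A: "f (c + e *\<^sub>R u + e *\<^sub>R w) - f (c + e *\<^sub>R u) - f (c + e *\<^sub>R w) + f c
      = e * e * ?A (c + s *\<^sub>R u + t *\<^sub>R w)" by blast
  from second_difference_mean_value[OF f e inS'] obtain s' t' where
    st': "s' \<in> {0..e}" "t' \<in> {0..e}" and B: "f (c + e *\<^sub>R w + e *\<^sub>R u) - f (c + e *\<^sub>R w) - f (c + e *\<^sub>R u) + f c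
      = e * e * ?B (c + s' *\<^sub>R w + t' *\<^sub>R u)" by blast
  have swap: "c + e *\<^sub>R w + e *\<^sub>R u = c + e *\<^sub>R u + e *\<^sub>R w" by (simp add: algebra_simps)
  have "e * e * ?A (c + s *\<^sub>R u + t *\<^sub>R w) = e * e * ?B (c + s' *\<^sub>R w + t' *\<^sub>R u)"
    using A B unfolding swap by linarith
  then have eq: "?A (c + s *\<^sub>R u + t *\<^sub>R w) = ?B (c + s' *\<^sub>R w + t' *\<^sub>R u)"
    using e by simp
  have "dist (?A (c + s *\<^sub>R u + t *\<^sub>R w)) (?A c) < \<epsilon>"
    using d1(2) near[OF st] by (simp add: d_def)
  moreover have "dist (?B (c + s' *\<^sub>R w + t' *\<^sub>R u)) (?B c) < \<epsilon>"
    using d2(2) near[OF st'(2,1)] by (simp add: d_def algebra_simps)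
  ultimately have "dist (?A c) (?B c) < dist (?A c) (?B c)"
    unfolding eq \<epsilon>_def by (rule dist_triangle_half_r)
  then show False by simp
qed

lemma frechet_derivative_slice_left:
  fixes F :: "'a::real_normed_vector \<times> 'b::real_normed_vector \<Rightarrow> real"
  assumes "smooth_on S F" "(c, d) \<in> S"
  shows "frechet_derivative (\<lambda>x. F (x, d)) (at c) w = frechet_derivative F (at (c, d)) (w, 0)"
proof -
  have "((\<lambda>x. (x, d)) has_derivative (\<lambda>w. (w, 0))) (at c)"
    by (auto intro!: derivative_eq_intros)
  from has_derivative_compose[OF this smooth_on_has_derivative[OF assms]]
  show ?thesis by (simp flip: frechet_derivative_at)
qed

lemma frechet_derivative_slice_right:
  fixes F :: "'a::real_normed_vector \<times> 'b::real_normed_vector \<Rightarrow> real"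
  assumes "smooth_on S F" "(c, d) \<in> S"
  shows "frechet_derivative (\<lambda>y. F (c, y)) (at d) w = frechet_derivative F (at (c, d)) (0, w)"
proof -
  have "((\<lambda>y. (c, y)) has_derivative (\<lambda>w. (0, w))) (at d)"
    by (auto intro!: derivative_eq_intros)
  from has_derivative_compose[OF this smooth_on_has_derivative[OF assms]]
  show ?thesis by (simp flip: frechet_derivative_at)
qed

section \<open>Smooth functions on a Lie group\<close>

locale real_lie_group =
  fixes G :: "('g::{t2_space, second_countable_topology}, 'e::euclidean_space) lie_group" (structure)
  assumes lie_group: "lie_group G"
begin

lemma smooth_atlas: "smooth_atlas (atlas G)"
  using lie_group by (simp add: lie_group_def)

lemma chart_homeomorphism:
  assumes "(U, \<phi>) \<in> atlas G"
  shows "open U" "open (\<phi> ` U)" "homeomorphism U (\<phi> ` U) \<phi> (inv_into U \<phi>)"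
  using smooth_atlas assms unfolding smooth_atlas_def by blast+

lemma chart_inverse:
  assumes "(U, \<phi>) \<in> atlas G"
  shows "p \<in> U \<Longrightarrow> inv_into U \<phi> (\<phi> p) = p"
    and "x \<in> \<phi> ` U \<Longrightarrow> inv_into U \<phi> x \<in> U"
    and "x \<in> \<phi> ` U \<Longrightarrow> \<phi> (inv_into U \<phi> x) = x"
  using chart_homeomorphism(3)[OF assms] by (auto simp: homeomorphism_def f_inv_into_f inv_into_into)

lemma chart_inverse_continuous: "(U, \<phi>) \<in> atlas G \<Longrightarrow> continuous_on (\<phi> ` U) (inv_into U \<phi>)"
  using chart_homeomorphism(3) by (auto simp: homeomorphism_def)

lemma chart_at:
  obtains U \<phi> where "(U, \<phi>) \<in> atlas G" "p \<in> U"
proof -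
  have "p \<in> (\<Union>(U, \<phi>)\<in>atlas G. U)" using smooth_atlas by (simp add: smooth_atlas_def)
  then show ?thesis using that by blast
qed

lemma transition_smooth:
  assumes "(U, \<phi>) \<in> atlas G" "(V, \<psi>) \<in> atlas G"
  shows "smooth_on (\<phi> ` (U \<inter> V)) (\<lambda>x. \<psi> (inv_into U \<phi> x))"
proof -
  have "smooth_on (\<phi> ` (U \<inter> V)) (\<psi> \<circ> inv_into U \<phi>)"
    using smooth_atlas assms unfolding smooth_atlas_def by blast
  then show ?thesis by (simp add: o_def)
qed

lemma chart_image_open:
  assumes "(U, \<phi>) \<in> atlas G" "open W"
  shows "open (\<phi> ` (U \<inter> W))"
proof -
  have "\<phi> ` (U \<inter> W) = \<phi> ` U \<inter> inv_into U \<phi> -` W"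
    using chart_inverse[OF assms(1)] by (auto simp: image_iff)
  moreover have "open (\<phi> ` U \<inter> inv_into U \<phi> -` W)"
    by (intro continuous_open_preimage chart_inverse_continuous chart_homeomorphism(2)[OF assms(1)] assms)
  ultimately show ?thesis by simp
qed

lemma C_infI:
  "(\<And>U \<phi>. (U, \<phi>) \<in> atlas G \<Longrightarrow> smooth_on (\<phi> ` U) (\<lambda>x. f (inv_into U \<phi> x))) \<Longrightarrow> f \<in> C_inf G"
  by (auto simp: C_inf_def o_def)

lemma C_infD:
  "f \<in> C_inf G \<Longrightarrow> (U, \<phi>) \<in> atlas G \<Longrightarrow> smooth_on (\<phi> ` U) (\<lambda>x. f (inv_into U \<phi> x))"
  by (auto simp: C_inf_def o_def)

lemma C_inf_const: "(\<lambda>x. c) \<in> C_inf G"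
  by (rule C_infI) (simp add: smooth_on_const chart_homeomorphism)

lemma C_inf_add: "f \<in> C_inf G \<Longrightarrow> h \<in> C_inf G \<Longrightarrow> (\<lambda>x. f x + h x) \<in> C_inf G"
  by (rule C_infI) (simp add: smooth_on_add chart_homeomorphism C_infD)

lemma C_inf_mult: "f \<in> C_inf G \<Longrightarrow> h \<in> C_inf G \<Longrightarrow> (\<lambda>x. f x * h x) \<in> C_inf G"
  by (rule C_infI) (simp add: smooth_on_mult chart_homeomorphism C_infD)

lemma C_inf_sum: "(\<And>i. i \<in> I \<Longrightarrow> f i \<in> C_inf G) \<Longrightarrow> (\<lambda>x. \<Sum>i\<in>I. f i x) \<in> C_inf G"
  by (rule C_infI) (simp add: smooth_on_sum chart_homeomorphism C_infD)

lemma C_inf_sum_list: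
  "(\<And>i. i \<in> set xs \<Longrightarrow> f i \<in> C_inf G) \<Longrightarrow> (\<lambda>x. \<Sum>i\<leftarrow>xs. f i x) \<in> C_inf G"
  by (induction xs) (auto intro: C_inf_const C_inf_add)

definition extend_by_zero :: "'g set \<Rightarrow> ('g \<Rightarrow> 'e) \<Rightarrow> ('e \<Rightarrow> real) \<Rightarrow> 'g \<Rightarrow> real" where
  "extend_by_zero U \<phi> h p = (if p \<in> U then h (\<phi> p) else 0)"

text \<open>Near a point of the chart domain the extension is the given function read through a transition map;
  every other point has a neighbourhood avoiding the preimage of \<open>K\<close>, which is compact and hence closed
  because the group is Hausdorff.\<close>

lemma extend_by_zero_C_inf:
  assumes U: "(U, \<phi>) \<in> atlas G" and h: "smooth_on UNIV h"
    and K: "compact K" "K \<subseteq> \<phi> ` U" "\<And>x. x \<notin> K \<Longrightarrow> h x = 0"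
  shows "extend_by_zero U \<phi> h \<in> C_inf G"
proof (intro C_infI smooth_on_local)
  fix V \<psi> y assume V: "(V, \<psi>) \<in> atlas G" and "y \<in> \<psi> ` V"
  then obtain p where p: "p \<in> V" "y = \<psi> p" by blast
  let ?e = "\<lambda>x. extend_by_zero U \<phi> h (inv_into V \<psi> x)"
  show "\<exists>T. open T \<and> y \<in> T \<and> smooth_on T ?e"
  proof (cases "p \<in> U")
    case True
    let ?T = "\<psi> ` (V \<inter> U)"
    have T: "open ?T" by (intro chart_image_open V chart_homeomorphism(1)[OF U])
    have "smooth_on ?T (\<lambda>x. h (\<phi> (inv_into V \<psi> x)))"
      by (rule smooth_on_compose[OF T open_UNIV _ transition_smooth[OF V U] h]) simp
    then have "smooth_on ?T ?e"
      by (rule smooth_on_cong[OF T, rotated])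
         (auto simp: extend_by_zero_def chart_inverse[OF V])
    then show ?thesis using T p True by blast
  next
    case False
    let ?K = "inv_into U \<phi> ` K"
    have "compact ?K"
      by (intro compact_continuous_image continuous_on_subset[OF chart_inverse_continuous[OF U]] K)
    then have "open (- ?K)" by (simp add: compact_imp_closed open_Compl)
    with chart_image_open[OF V] have T: "open (\<psi> ` (V \<inter> - ?K))" .
    have "?e x = 0" if x: "x \<in> \<psi> ` (V \<inter> - ?K)" for x
    proof -
      obtain q where q: "q \<in> V" "q \<notin> ?K" "x = \<psi> q" using x by blast
      have "h (\<phi> q) = 0" if "q \<in> U"
        using that q(2) K(3) chart_inverse(1)[OF U that] by (metis imageI)
      then show ?thesis using q by (simp add: extend_by_zero_def chart_inverse[OF V])
    qed
    then have "smooth_on (\<psi> ` (V \<inter> - ?K)) ?e"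
      by (intro smooth_on_cong[OF T _ smooth_on_const[OF T, of 0]]) simp
    moreover have "p \<notin> ?K" using False chart_inverse(2)[OF U] K(2) by blast
    ultimately show ?thesis using T p by blast
  qed
qed

section \<open>Tangent vectors and covectors in charts\<close>

lemma tangent_vectorD:
  assumes "v \<in> tangent_space G p"
  shows "f \<in> C_inf G \<Longrightarrow> h \<in> C_inf G \<Longrightarrow> v (\<lambda>x. f x + h x) = v f + v h"
    and "f \<in> C_inf G \<Longrightarrow> v (\<lambda>x. c * f x) = c * v f"
    and "f \<in> C_inf G \<Longrightarrow> h \<in> C_inf G \<Longrightarrow> v (\<lambda>x. f x * h x) = f p * v h + v f * h p"
    and "f \<notin> C_inf G \<Longrightarrow> v f = 0"
  using assms unfolding tangent_space_def by auto

lemma tangent_vector_zero: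
  assumes "v \<in> tangent_space G p" shows "v (\<lambda>x. 0) = 0"
  using tangent_vectorD(2)[OF assms C_inf_const, of 0 0] by simp

lemma tangent_vector_sum:
  assumes "v \<in> tangent_space G p" "\<And>i. i \<in> I \<Longrightarrow> f i \<in> C_inf G"
  shows "v (\<lambda>x. \<Sum>i\<in>I. f i x) = (\<Sum>i\<in>I. v (f i))"
  using assms(2)
proof (induction I rule: infinite_finite_induct)
  case (insert i I)
  then show ?case
    by (simp add: tangent_vectorD(1)[OF assms(1)] C_inf_sum)
qed (auto simp: tangent_vector_zero[OF assms(1)])

lemma tangent_vector_sum_list:
  assumes "v \<in> tangent_space G p" "\<And>i. i \<in> set xs \<Longrightarrow> f i \<in> C_inf G"
  shows "v (\<lambda>x. \<Sum>i\<leftarrow>xs. f i x) = (\<Sum>i\<leftarrow>xs. v (f i))"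
  using assms(2)
  by (induction xs) 
     (auto simp: tangent_vector_zero[OF assms(1)] tangent_vectorD(1)[OF assms(1)] C_inf_sum_list)

lemma tangent_space_add:
  "v \<in> tangent_space G p \<Longrightarrow> w \<in> tangent_space G p \<Longrightarrow> (\<lambda>f. v f + w f) \<in> tangent_space G p"
  unfolding tangent_space_def by (simp add: algebra_simps)

lemma tangent_space_scale: "v \<in> tangent_space G p \<Longrightarrow> (\<lambda>f. c * v f) \<in> tangent_space G p"
  unfolding tangent_space_def by (simp add: algebra_simps)

lemma tangent_space_zero: "(\<lambda>f. 0) \<in> tangent_space G p"
  unfolding tangent_space_def by simp

lemma tangent_space_sum:
  "(\<And>i. i \<in> I \<Longrightarrow> v i \<in> tangent_space G p) \<Longrightarrow> (\<lambda>f. \<Sum>i\<in>I. v i f) \<in> tangent_space G p"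
  by (induction I rule: infinite_finite_induct) (auto intro: tangent_space_zero tangent_space_add)

text \<open>A derivation is the directional derivative along its own components. Let \<open>\<rho>\<close> be a bump function at
  \<open>\<phi> p\<close>. Hadamard's lemma, multiplied by \<open>\<rho>\<^sup>2\<close> and extended by zero, is an identity between smooth functions
  on the whole group, with one factor \<open>\<rho>\<close> going to the coordinate and one to its coefficient. Applying
  \<open>v\<close> by the Leibniz rule leaves the derivatives of \<open>f\<close>, weighted by the values of \<open>v\<close> on the cut-off
  coordinates \<open>\<xi> b\<close>. Working with a global identity avoids a separate proof that derivations are local.
  That the \<open>\<xi> b\<close> do not depend on \<open>v\<close> is used to realise covectors as differentials.\<close>

lemma tangent_vector_in_chart:
  assumes U: "(U, \<phi>) \<in> atlas G" and p: "p \<in> U"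
  obtains \<xi> where "\<And>b. \<xi> b \<in> C_inf G"
    and "\<And>v f. v \<in> tangent_space G p \<Longrightarrow> f \<in> C_inf G \<Longrightarrow> v f =
      (\<Sum>b\<in>Basis. v (\<xi> b) * frechet_derivative (\<lambda>x. f (inv_into U \<phi> x)) (at (\<phi> p)) b)"
proof -
  let ?c = "\<phi> p" and ?E = "extend_by_zero U \<phi>"
  obtain R where R: "R > 0" "ball ?c R \<subseteq> \<phi> ` U"
    using chart_homeomorphism(2)[OF U] p openE by blast
  let ?K = "cball ?c (R / 2)"
  have K: "compact ?K" "?K \<subseteq> ball ?c R" using R(1) by auto
  then have KU: "?K \<subseteq> \<phi> ` U" using R(2) by blast
  obtain \<rho> :: "'e \<Rightarrow> real" where \<rho>: "smooth_on UNIV \<rho>" "\<rho> ?c = 1" "\<And>x. x \<notin> ball ?c (R / 2) \<Longrightarrow> \<rho> x = 0"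
    using smooth_bump[OF half_gt_zero[OF R(1)], of ?c] by metis
  have \<rho>0: "\<rho> x = 0" if "x \<notin> ?K" for x using \<rho>(3) that by auto
  have cut: "?E (\<lambda>x. \<rho> x * g x) \<in> C_inf G" if g: "smooth_on (ball ?c R) g" for g :: "'e \<Rightarrow> real"
  proof (rule extend_by_zero_C_inf[OF U _ K(1) KU])
    show "smooth_on UNIV (\<lambda>x. \<rho> x * g x)"
    proof (rule smooth_on_local)
      fix x :: 'e
      have "smooth_on (ball ?c R) (\<lambda>x. \<rho> x * g x)"
        by (intro smooth_on_mult g open_ball smooth_on_subset[OF \<rho>(1)]) simp
      moreover have "smooth_on (- ?K) (\<lambda>x. \<rho> x * g x)"
        by (rule smooth_on_cong[OF _ _ smooth_on_const[where c = 0]]) (auto intro: \<rho>0 simp: open_Compl)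
      moreover have "x \<in> ball ?c R \<or> x \<in> - ?K" using K(2) by blast
      ultimately show "\<exists>T. open T \<and> x \<in> T \<and> smooth_on T (\<lambda>x. \<rho> x * g x)"
        using open_ball open_Compl[OF closed_cball] by metis
    qed
  qed (simp add: \<rho>0)
  let ?\<xi> = "\<lambda>b. ?E (\<lambda>x. \<rho> x * ((x - ?c) \<bullet> b))"
  have \<xi>: "?\<xi> b \<in> C_inf G" for b
    by (intro cut smooth_on_subset[OF smooth_on_inner_shift]) simp
  show thesis
  proof (rule that[of ?\<xi>])
    fix v f assume v: "v \<in> tangent_space G p" and f: "f \<in> C_inf G"
    let ?f = "\<lambda>x. f (inv_into U \<phi> x)"
    obtain g where g: "\<forall>b. smooth_on (ball ?c R) (g b)" "\<forall>b. g b ?c = frechet_derivative ?f (at ?c) b"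
      "\<forall>x\<in>ball ?c R. ?f x = ?f ?c + (\<Sum>b\<in>Basis. ((x - ?c) \<bullet> b) * g b x)"
      using hadamard_lemma[OF smooth_on_subset[OF C_infD[OF f U] R(2)] R(1)] by blast
    let ?\<rho> = "?E (\<lambda>x. \<rho> x * 1)" and ?g = "\<lambda>b. ?E (\<lambda>x. \<rho> x * g b x)"
    have \<rho>': "?\<rho> \<in> C_inf G" by (intro cut smooth_on_const open_ball)
    have g': "?g b \<in> C_inf G" for b by (rule cut) (use g(1) in blast)
    \<comment> \<open>Hadamard's lemma times the square of the bump function; both sides vanish off the ball.\<close>
    have "?\<rho> q * ?\<rho> q * f q = f p * (?\<rho> q * ?\<rho> q) + (\<Sum>b\<in>Basis. ?\<xi> b q * ?g b q)" for q
    proof (cases "q \<in> U \<and> \<phi> q \<in> ball ?c R")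
      case True
      then have "f q = f p + (\<Sum>b\<in>Basis. ((\<phi> q - ?c) \<bullet> b) * g b (\<phi> q))"
        using bspec[OF g(3), of "\<phi> q"] chart_inverse(1)[OF U] p by simp
      then show ?thesis
        using True by (simp add: extend_by_zero_def algebra_simps sum_distrib_left)
    next
      case False
      then have "q \<in> U \<Longrightarrow> \<rho> (\<phi> q) = 0" using \<rho>0[of "\<phi> q"] K(2) by blast
      then show ?thesis by (simp add: extend_by_zero_def)
    qed
    then have "v (\<lambda>q. ?\<rho> q * ?\<rho> q * f q) =
        v (\<lambda>q. f p * (?\<rho> q * ?\<rho> q) + (\<Sum>b\<in>Basis. ?\<xi> b q * ?g b q))"
      by (intro arg_cong[of _ _ v] ext)
    also have "\<dots> = f p * v (\<lambda>q. ?\<rho> q * ?\<rho> q) + (\<Sum>b\<in>Basis. v (\<lambda>q. ?\<xi> b q * ?g b q))"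
      using \<rho>' g' \<xi> 
      by (simp add: tangent_vectorD(1,2)[OF v] tangent_vector_sum[OF v] C_inf_mult C_inf_const C_inf_sum)
    also have "v (\<lambda>q. ?\<rho> q * ?\<rho> q * f q) = v f + f p * v (\<lambda>q. ?\<rho> q * ?\<rho> q)"
      using tangent_vectorD(3)[OF v C_inf_mult[OF \<rho>' \<rho>'] f] p \<rho>(2) by (simp add: extend_by_zero_def)
    finally have "v f = (\<Sum>b\<in>Basis. v (\<lambda>q. ?\<xi> b q * ?g b q))" by simp
    also have "\<dots> = (\<Sum>b\<in>Basis. v (?\<xi> b) * frechet_derivative ?f (at ?c) b)"
    proof (rule sum.cong[OF refl])
      show "v (\<lambda>q. ?\<xi> b q * ?g b q) = v (?\<xi> b) * frechet_derivative ?f (at ?c) b" for b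
        using tangent_vectorD(3)[OF v \<xi> g', of b b] p g(2) \<rho>(2) by (simp add: extend_by_zero_def)
    qed
    finally show "v f = (\<Sum>b\<in>Basis. v (?\<xi> b) * frechet_derivative ?f (at ?c) b)" .
  qed (rule \<xi>)
qed

lemma tangent_vector_as_direction:
  assumes U: "(U, \<phi>) \<in> atlas G" "p \<in> U" and v: "v \<in> tangent_space G p"
  obtains w where "\<And>f. f \<in> C_inf G \<Longrightarrow>
    v f = frechet_derivative (\<lambda>x. f (inv_into U \<phi> x)) (at (\<phi> p)) w"
proof -
  obtain \<xi> where \<xi>: "\<And>f. f \<in> C_inf G \<Longrightarrow> v f =
      (\<Sum>b\<in>Basis. v (\<xi> b) * frechet_derivative (\<lambda>x. f (inv_into U \<phi> x)) (at (\<phi> p)) b)"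
    using tangent_vector_in_chart[OF U] v by metis
  show thesis
  proof (rule that[of "\<Sum>b\<in>Basis. v (\<xi> b) *\<^sub>R b"])
    fix f assume f: "f \<in> C_inf G"
    have l: "linear (frechet_derivative (\<lambda>x. f (inv_into U \<phi> x)) (at (\<phi> p)))"
      using linear_frechet_derivative_smooth[OF C_infD[OF f U(1)]] U(2) by blast
    show "v f = frechet_derivative (\<lambda>x. f (inv_into U \<phi> x)) (at (\<phi> p)) (\<Sum>b\<in>Basis. v (\<xi> b) *\<^sub>R b)"
      unfolding linear_sum[OF l] linear_cmul[OF l] by (simp add: \<xi>[OF f])
  qed
qed

definition chart_vector :: "'g set \<Rightarrow> ('g \<Rightarrow> 'e) \<Rightarrow> 'g \<Rightarrow> 'e \<Rightarrow> 'g tvec" where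
  "chart_vector U \<phi> p w = (\<lambda>f. if f \<in> C_inf G
     then frechet_derivative (\<lambda>x. f (inv_into U \<phi> x)) (at (\<phi> p)) w else 0)"

lemma chart_vector_in_tangent_space:
  assumes U: "(U, \<phi>) \<in> atlas G" "p \<in> U"
  shows "chart_vector U \<phi> p w \<in> tangent_space G p"
proof -
  let ?D = "\<lambda>f. frechet_derivative (\<lambda>x. f (inv_into U \<phi> x)) (at (\<phi> p))"
  have d: "((\<lambda>x. f (inv_into U \<phi> x)) has_derivative ?D f) (at (\<phi> p))" if "f \<in> C_inf G" for f
    using smooth_on_has_derivative[OF C_infD[OF that U(1)]] U(2) by blast
  have "?D (\<lambda>x. f x + h x) w = ?D f w + ?D h w" if "f \<in> C_inf G" "h \<in> C_inf G" for f h
    by (simp flip: frechet_derivative_at[OF has_derivative_add[OF d[OF that(1)] d[OF that(2)]]])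
  moreover have "?D (\<lambda>x. c * f x) w = c * ?D f w" if "f \<in> C_inf G" for f c
    by (simp flip: frechet_derivative_at[OF has_derivative_mult_right[OF d[OF that]]])
  moreover have "?D (\<lambda>x. f x * h x) w = f p * ?D h w + ?D f w * h p"
    if "f \<in> C_inf G" "h \<in> C_inf G" for f h
    by (simp add: chart_inverse(1)[OF U]
        flip: frechet_derivative_at[OF has_derivative_mult[OF d[OF that(1)] d[OF that(2)]]])
  ultimately show ?thesis
    unfolding tangent_space_def chart_vector_def
    by (simp add: C_inf_add C_inf_mult C_inf_const)
qed

lemma cotangentD:
  assumes "\<theta> \<in> cotangent_space G p" "v \<in> tangent_space G p"
  shows "w \<in> tangent_space G p \<Longrightarrow> \<theta> (\<lambda>f. v f + w f) = \<theta> v + \<theta> w"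
    and "\<theta> (\<lambda>f. c * v f) = c * \<theta> v"
  using assms unfolding cotangent_space_def by blast+

lemma cotangent_sum:
  assumes \<theta>: "\<theta> \<in> cotangent_space G p" and "finite I" "\<And>i. i \<in> I \<Longrightarrow> v i \<in> tangent_space G p"
  shows "\<theta> (\<lambda>f. \<Sum>i\<in>I. c i * v i f) = (\<Sum>i\<in>I. c i * \<theta> (v i))"
  using assms(2,3)
proof (induction I rule: finite_induct)
  case empty
  show ?case using cotangentD(2)[OF \<theta> tangent_space_zero, of 0] by simp
next
  case (insert i I)
  have "\<theta> (\<lambda>f. c i * v i f + (\<Sum>i\<in>I. c i * v i f)) = \<theta> (\<lambda>f. c i * v i f) + \<theta> (\<lambda>f. \<Sum>i\<in>I. c i * v i f)"
    by (intro cotangentD(1)[OF \<theta>] tangent_space_scale tangent_space_sum insert.prems) auto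
  moreover have "\<theta> (\<lambda>f. c i * v i f) = c i * \<theta> (v i)"
    by (intro cotangentD(2)[OF \<theta>] insert.prems) simp
  ultimately show ?case using insert by simp
qed

text \<open>In terms of the cut-off coordinates \<open>\<xi> b\<close> around \<open>p\<close>, take \<open>a = (\<Sum>b. \<theta> (\<partial>\<^sub>b) * \<xi> b)\<close>. This is where it
  matters that the tangent space, although defined by derivations, is spanned by the finitely many
  coordinate vectors.\<close>

lemma cotangent_is_differential:
  assumes "\<theta> \<in> cotangent_space G p"
  obtains a where "a \<in> C_inf G" "\<And>v. v \<in> tangent_space G p \<Longrightarrow> \<theta> v = v a"
proof -
  obtain U \<phi> where U: "(U, \<phi>) \<in> atlas G" "p \<in> U" by (rule chart_at)
  show thesis
  proof (rule tangent_vector_in_chart[OF U])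
    fix \<xi> assume \<xi>: "\<And>b. \<xi> b \<in> C_inf G"
      and v_eq: "\<And>v f. v \<in> tangent_space G p \<Longrightarrow> f \<in> C_inf G \<Longrightarrow> v f =
        (\<Sum>b\<in>Basis. v (\<xi> b) * frechet_derivative (\<lambda>x. f (inv_into U \<phi> x)) (at (\<phi> p)) b)"
    let ?d = "chart_vector U \<phi> p"
    show thesis
    proof (rule that[of "\<lambda>x. \<Sum>b\<in>Basis. \<theta> (?d b) * \<xi> b x"])
      show "(\<lambda>x. \<Sum>b\<in>Basis. \<theta> (?d b) * \<xi> b x) \<in> C_inf G"
        by (intro C_inf_sum C_inf_mult C_inf_const \<xi>)
      fix v assume v: "v \<in> tangent_space G p"
      have "v f = (\<Sum>b\<in>Basis. v (\<xi> b) * ?d b f)" for f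
      proof (cases "f \<in> C_inf G")
        case True
        show ?thesis unfolding chart_vector_def if_P[OF True] by (rule v_eq[OF v True])
      next
        case False
        then show ?thesis by (simp add: chart_vector_def tangent_vectorD(4)[OF v])
      qed
      then have "v = (\<lambda>f. \<Sum>b\<in>Basis. v (\<xi> b) * ?d b f)" by (rule ext)
      then have "\<theta> v = \<theta> (\<lambda>f. \<Sum>b\<in>Basis. v (\<xi> b) * ?d b f)" by (rule arg_cong)
      also have "\<dots> = (\<Sum>b\<in>Basis. v (\<xi> b) * \<theta> (?d b))"
        by (intro cotangent_sum[OF assms] chart_vector_in_tangent_space U finite_Basis)
      also have "\<dots> = v (\<lambda>x. \<Sum>b\<in>Basis. \<theta> (?d b) * \<xi> b x)"
        by (simp add: tangent_vector_sum[OF v] tangent_vectorD(2)[OF v] C_inf_mult C_inf_const \<xi>)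
           (simp add: mult.commute)
      finally show "\<theta> v = v (\<lambda>x. \<Sum>b\<in>Basis. \<theta> (?d b) * \<xi> b x)" .
    qed
  qed
qed

section \<open>Smooth functions of two group elements\<close>

definition C_inf2 :: "('g \<Rightarrow> 'g \<Rightarrow> real) set" where
  "C_inf2 = {F. \<forall>(U, \<phi>)\<in>atlas G. \<forall>(V, \<psi>)\<in>atlas G.
     smooth_on (\<phi> ` U \<times> \<psi> ` V) (\<lambda>(x, y). F (inv_into U \<phi> x) (inv_into V \<psi> y))}"

lemma C_inf2D:
  assumes "F \<in> C_inf2" "(U, \<phi>) \<in> atlas G" "(V, \<psi>) \<in> atlas G"
  shows "smooth_on (\<phi> ` U \<times> \<psi> ` V) (\<lambda>(x, y). F (inv_into U \<phi> x) (inv_into V \<psi> y))"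
  using assms unfolding C_inf2_def by blast

lemma C_inf2_swap:
  assumes "F \<in> C_inf2"
  shows "(\<lambda>x y. F y x) \<in> C_inf2"
proof -
  have "smooth_on (\<phi> ` U \<times> \<psi> ` V) (\<lambda>(x, y). F (inv_into V \<psi> y) (inv_into U \<phi> x))"
    if U: "(U, \<phi>) \<in> atlas G" and V: "(V, \<psi>) \<in> atlas G" for U \<phi> V \<psi>
  proof -
    have o: "open (\<phi> ` U \<times> \<psi> ` V)" "open (\<psi> ` V \<times> \<phi> ` U)"
      by (intro open_Times chart_homeomorphism(2)[OF U] chart_homeomorphism(2)[OF V])+
    have "bounded_linear (\<lambda>z. (snd z, fst z))" 
      by (intro bounded_linear_Pair bounded_linear_fst bounded_linear_snd)
    then have "smooth_on (\<phi> ` U \<times> \<psi> ` V) (\<lambda>z. (\<lambda>(x, y). F (inv_into V \<psi> x) (inv_into U \<phi> y)) (snd z, fst z))"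
      by (intro smooth_on_compose[OF o _ smooth_on_linear[OF o(1)] C_inf2D[OF assms V U]]) auto
    then show ?thesis by (simp add: case_prod_unfold)
  qed
  then show ?thesis unfolding C_inf2_def by blast
qed

lemma slice_derivative:
  assumes F: "F \<in> C_inf2" and U: "(U, \<phi>) \<in> atlas G" "p \<in> U" and V: "(V, \<psi>) \<in> atlas G"
  shows "smooth_on (\<psi> ` V) (\<lambda>y. F p (inv_into V \<psi> y))"
    and "smooth_on (\<psi> ` V) (\<lambda>y. frechet_derivative (\<lambda>x. F (inv_into U \<phi> x) (inv_into V \<psi> y)) (at (\<phi> p)) w)"
proof -
  let ?F = "\<lambda>(x, y). F (inv_into U \<phi> x) (inv_into V \<psi> y)"
  note s = C_inf2D[OF F U(1) V]
  have o: "open (\<psi> ` V)" "open (\<phi> ` U \<times> \<psi> ` V)"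
    by (intro open_Times chart_homeomorphism(2)[OF U(1)] chart_homeomorphism(2)[OF V])+
  have sub: "Pair (\<phi> p) ` \<psi> ` V \<subseteq> \<phi> ` U \<times> \<psi> ` V" using U(2) by blast
  have Pair: "smooth_on (\<psi> ` V) (\<lambda>y. (\<phi> p, y))" by (rule smooth_on_subset[OF smooth_on_Pair_left]) simp
  from smooth_on_compose[OF o sub Pair s]
  show "smooth_on (\<psi> ` V) (\<lambda>y. F p (inv_into V \<psi> y))" by (simp add: chart_inverse(1)[OF U])
  have "smooth_on (\<psi> ` V) (\<lambda>y. frechet_derivative ?F (at (\<phi> p, y)) (w, 0))"
    by (rule smooth_on_compose[OF o sub Pair smooth_on_frechet_derivative[OF s]])
  then show "smooth_on (\<psi> ` V) (\<lambda>y. frechet_derivative (\<lambda>x. F (inv_into U \<phi> x) (inv_into V \<psi> y)) (at (\<phi> p)) w)"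
  proof (rule smooth_on_cong[OF o(1), rotated])
    fix y assume "y \<in> \<psi> ` V"
    then have "(\<phi> p, y) \<in> \<phi> ` U \<times> \<psi> ` V" using U(2) by blast
    from frechet_derivative_slice_left[OF s this, of w]
    show "frechet_derivative ?F (at (\<phi> p, y)) (w, 0) =
        frechet_derivative (\<lambda>x. F (inv_into U \<phi> x) (inv_into V \<psi> y)) (at (\<phi> p)) w" by simp
  qed
qed

lemma C_inf2_slice: "F \<in> C_inf2 \<Longrightarrow> F p \<in> C_inf G"
  using slice_derivative(1) chart_at[of p] C_infI by metis

lemma C_inf2_slice': "F \<in> C_inf2 \<Longrightarrow> (\<lambda>x. F x q) \<in> C_inf G"
  using C_inf2_slice[OF C_inf2_swap] .

text \<open>In charts, applying a tangent vector to one of the two variables is a partial derivative of a smooth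
  function in a fixed direction.\<close>

lemma partial_derivative_C_inf:
  assumes F: "F \<in> C_inf2" and v: "v \<in> tangent_space G p"
  shows "(\<lambda>h. v (\<lambda>x. F x h)) \<in> C_inf G"
proof (rule C_infI)
  fix V \<psi> assume V: "(V, \<psi>) \<in> atlas G"
  obtain U \<phi> where U: "(U, \<phi>) \<in> atlas G" "p \<in> U" by (rule chart_at)
  obtain w where "\<And>f. f \<in> C_inf G \<Longrightarrow> v f = frechet_derivative (\<lambda>x. f (inv_into U \<phi> x)) (at (\<phi> p)) w"
    using tangent_vector_as_direction[OF U v] by metis
  then show "smooth_on (\<psi> ` V) (\<lambda>y. v (\<lambda>x. F x (inv_into V \<psi> y)))"
    using slice_derivative(2)[OF F U V, of w] C_inf2_slice'[OF F] by simp
qed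

text \<open>In charts the two sides are the two mixed second derivatives in the directions \<open>(w, 0)\<close> and \<open>(0, z)\<close>.\<close>

lemma partial_derivatives_commute:
  assumes F: "F \<in> C_inf2" and v: "v \<in> tangent_space G p" and u: "u \<in> tangent_space G q"
  shows "u (\<lambda>h. v (\<lambda>x. F x h)) = v (\<lambda>x. u (\<lambda>h. F x h))"
proof -
  obtain U \<phi> where U: "(U, \<phi>) \<in> atlas G" "p \<in> U" by (rule chart_at)
  obtain V \<psi> where V: "(V, \<psi>) \<in> atlas G" "q \<in> V" by (rule chart_at)
  obtain w where w: "\<And>f. f \<in> C_inf G \<Longrightarrow> v f = frechet_derivative (\<lambda>x. f (inv_into U \<phi> x)) (at (\<phi> p)) w"
    using tangent_vector_as_direction[OF U v] by metis
  obtain z where z: "\<And>f. f \<in> C_inf G \<Longrightarrow> u f = frechet_derivative (\<lambda>y. f (inv_into V \<psi> y)) (at (\<psi> q)) z"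
    using tangent_vector_as_direction[OF V u] by metis
  let ?S = "\<phi> ` U \<times> \<psi> ` V" and ?F = "\<lambda>(x, y). F (inv_into U \<phi> x) (inv_into V \<psi> y)"
  let ?D = "\<lambda>t. frechet_derivative ?F (at t)"
  have s: "smooth_on ?S ?F" by (rule C_inf2D[OF F U(1) V(1)])
  have o: "open (\<phi> ` U)" "open (\<psi> ` V)" "open ?S" by (intro open_Times chart_homeomorphism(2)[OF U(1)] chart_homeomorphism(2)[OF V(1)])+
  have pq: "(\<phi> p, \<psi> q) \<in> ?S" using U V by blast
  have "u (\<lambda>h. v (\<lambda>x. F x h)) = frechet_derivative (\<lambda>y. v (\<lambda>x. F x (inv_into V \<psi> y))) (at (\<psi> q)) z"
    by (rule z[OF partial_derivative_C_inf[OF F v]])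
  also have "\<dots> = frechet_derivative (\<lambda>y. ?D (\<phi> p, y) (w, 0)) (at (\<psi> q)) z"
  proof -
    have eq: "v (\<lambda>x. F x (inv_into V \<psi> y)) = ?D (\<phi> p, y) (w, 0)" if "y \<in> \<psi> ` V" for y
      using frechet_derivative_slice_left[OF s, of "\<phi> p" y w] that U(2) w[OF C_inf2_slice'[OF F]] by simp
    have "(\<lambda>y. v (\<lambda>x. F x (inv_into V \<psi> y))) differentiable (at (\<psi> q))"
      by (rule differentiableI[OF smooth_on_has_derivative[OF
            C_infD[OF partial_derivative_C_inf[OF F v] V(1)] imageI[OF V(2)]]])
    then show ?thesis
      by (simp add: frechet_derivative_transform_within_open[OF _ o(2) imageI[OF V(2)] eq])
  qed
  also have "\<dots> = frechet_derivative (\<lambda>t. ?D t (w, 0)) (at (\<phi> p, \<psi> q)) (0, z)"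
    by (rule frechet_derivative_slice_right[OF smooth_on_frechet_derivative[OF s] pq])
  also have "\<dots> = frechet_derivative (\<lambda>t. ?D t (0, z)) (at (\<phi> p, \<psi> q)) (w, 0)"
    by (rule frechet_derivative_commute[OF o(3) pq s])
  also have "\<dots> = frechet_derivative (\<lambda>x. ?D (x, \<psi> q) (0, z)) (at (\<phi> p)) w"
    by (rule frechet_derivative_slice_left[OF smooth_on_frechet_derivative[OF s] pq, symmetric])
  also have "\<dots> = frechet_derivative (\<lambda>x. u (\<lambda>h. F (inv_into U \<phi> x) h)) (at (\<phi> p)) w"
  proof -
    have eq: "u (\<lambda>h. F (inv_into U \<phi> x) h) = ?D (x, \<psi> q) (0, z)" if "x \<in> \<phi> ` U" for x
      using frechet_derivative_slice_right[OF s, of x "\<psi> q" z] that V(2) z[OF C_inf2_slice[OF F]] by simp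
    have "(\<lambda>x. u (\<lambda>h. F (inv_into U \<phi> x) h)) differentiable (at (\<phi> p))"
      by (rule differentiableI[OF smooth_on_has_derivative[OF
            C_infD[OF partial_derivative_C_inf[OF C_inf2_swap[OF F] u] U(1)] imageI[OF U(2)]]])
    then show ?thesis
      by (simp add: frechet_derivative_transform_within_open[OF _ o(1) imageI[OF U(2)] eq])
  qed
  also have "\<dots> = v (\<lambda>x. u (\<lambda>h. F x h))"
    by (rule w[OF partial_derivative_C_inf[OF C_inf2_swap[OF F] u], symmetric])
  finally show ?thesis .
qed

section \<open>Translations and the Lie bracket\<close>

lemma group: "group G" and carrier_UNIV: "x \<in> carrier G"
  using lie_group by (auto simp: lie_group_def)

lemma mult_one: "\<one> \<otimes> x = x" "x \<otimes> \<one> = x"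
  and mult_assoc: "x \<otimes> y \<otimes> z = x \<otimes> (y \<otimes> z)"
  and mult_inv: "inv x \<otimes> (x \<otimes> y) = y" "x \<otimes> (inv x \<otimes> y) = y"
proof -
  interpret group G by (rule group)
  note [simp] = carrier_UNIV
  show "\<one> \<otimes> x = x" "x \<otimes> \<one> = x" "x \<otimes> y \<otimes> z = x \<otimes> (y \<otimes> z)"
    by (simp_all add: m_assoc)
  show "inv x \<otimes> (x \<otimes> y) = y" "x \<otimes> (inv x \<otimes> y) = y"
    by (simp_all add: m_assoc[symmetric])
qed

lemma prod_chart_inverse:
  assumes U: "(U, \<phi>) \<in> atlas G" and V: "(V, \<psi>) \<in> atlas G" and z: "z \<in> \<phi> ` U \<times> \<psi> ` V"
  shows "inv_into (U \<times> V) (map_prod \<phi> \<psi>) z = (inv_into U \<phi> (fst z), inv_into V \<psi> (snd z))"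
proof -
  let ?p = "(inv_into U \<phi> (fst z), inv_into V \<psi> (snd z))"
  have "inj_on \<phi> U" "inj_on \<psi> V"
    using chart_inverse(1)[OF U] chart_inverse(1)[OF V] by (metis inj_onI)+
  then have "inj_on (map_prod \<phi> \<psi>) (U \<times> V)" by (rule map_prod_inj_on)
  moreover have "?p \<in> U \<times> V" "map_prod \<phi> \<psi> ?p = z"
    using z chart_inverse[OF U] chart_inverse[OF V] by (auto simp: mem_Times_iff)
  ultimately show ?thesis by (metis inv_into_f_f)
qed

text \<open>Smoothness of the multiplication is given in product charts. Around each pair one composes it with
  a chart at the product and glues the results.\<close>

lemma mult_C_inf2:
  assumes a: "a \<in> C_inf G"
  shows "(\<lambda>x y. a (x \<otimes> y)) \<in> C_inf2"
proof -
  let ?m = "\<lambda>(x, y). x \<otimes> y"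
  have m: "smooth_map (prod_atlas (atlas G) (atlas G)) (atlas G) ?m"
    using lie_group by (simp add: lie_group_def)
  have "smooth_on (\<phi> ` U \<times> \<psi> ` V) (\<lambda>(x, y). a (inv_into U \<phi> x \<otimes> inv_into V \<psi> y))"
    if U: "(U, \<phi>) \<in> atlas G" and V: "(V, \<psi>) \<in> atlas G" for U \<phi> V \<psi>
  proof (rule smooth_on_local)
    let ?i = "\<lambda>z. (inv_into U \<phi> (fst z), inv_into V \<psi> (snd z))"
    fix z assume z: "z \<in> \<phi> ` U \<times> \<psi> ` V"
    obtain W \<zeta> where W: "(W, \<zeta>) \<in> atlas G" "?m (?i z) \<in> W" by (rule chart_at)
    let ?T = "(\<phi> ` U \<times> \<psi> ` V) \<inter> ?i -` (?m -` W)"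
    have "open (?m -` W)"
      by (rule open_vimage[OF chart_homeomorphism(1)[OF W(1)]]) (use m in \<open>simp add: smooth_map_def\<close>)
    moreover have "continuous_on (\<phi> ` U \<times> \<psi> ` V) ?i"
      by (intro continuous_on_Pair continuous_on_compose2[OF chart_inverse_continuous[OF U]]
          continuous_on_compose2[OF chart_inverse_continuous[OF V]] continuous_intros) auto
    moreover have "open (\<phi> ` U \<times> \<psi> ` V)"
      by (intro open_Times chart_homeomorphism(2)[OF U] chart_homeomorphism(2)[OF V])
    ultimately have T: "open ?T" by (intro continuous_open_preimage)
    have T_eq: "map_prod \<phi> \<psi> ` ((U \<times> V) \<inter> ?m -` W) = ?T"
    proof
      show "map_prod \<phi> \<psi> ` ((U \<times> V) \<inter> ?m -` W) \<subseteq> ?T"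
        using chart_inverse(1)[OF U] chart_inverse(1)[OF V] by auto
      show "?T \<subseteq> map_prod \<phi> \<psi> ` ((U \<times> V) \<inter> ?m -` W)"
      proof
        fix t assume t: "t \<in> ?T"
        then have "t = map_prod \<phi> \<psi> (?i t)" "?i t \<in> U \<times> V"
          using chart_inverse[OF U] chart_inverse[OF V] by (auto simp: mem_Times_iff)
        then show "t \<in> map_prod \<phi> \<psi> ` ((U \<times> V) \<inter> ?m -` W)" using t by blast
      qed
    qed
    have "(U \<times> V, map_prod \<phi> \<psi>) \<in> prod_atlas (atlas G) (atlas G)"
      using U V by (auto simp: prod_atlas_def)
    then have "smooth_on ?T (\<zeta> \<circ> ?m \<circ> inv_into (U \<times> V) (map_prod \<phi> \<psi>))"
      using m W(1) unfolding smooth_map_def T_eq[symmetric] by blast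
    then have s: "smooth_on ?T (\<lambda>t. \<zeta> (?m (?i t)))"
      by (rule smooth_on_cong[OF T, rotated]) (auto simp: prod_chart_inverse[OF U V])
    have "smooth_on ?T (\<lambda>t. a (inv_into W \<zeta> (\<zeta> (?m (?i t)))))"
      by (rule smooth_on_compose[OF T chart_homeomorphism(2)[OF W(1)] _ s C_infD[OF a W(1)]]) auto
    then have "smooth_on ?T (\<lambda>(x, y). a (inv_into U \<phi> x \<otimes> inv_into V \<psi> y))"
      by (rule smooth_on_cong[OF T, rotated]) (auto simp: chart_inverse(1)[OF W(1)])
    then show "\<exists>T. open T \<and> z \<in> T \<and> smooth_on T (\<lambda>(x, y). a (inv_into U \<phi> x \<otimes> inv_into V \<psi> y))"
      using T z W(2) by blast
  qed
  then show ?thesis unfolding C_inf2_def by blast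
qed

lemma left_translate_C_inf: "a \<in> C_inf G \<Longrightarrow> (\<lambda>x. a (g \<otimes> x)) \<in> C_inf G"
  using C_inf2_slice[OF mult_C_inf2] .

lemma left_translate_C_inf_iff: "(\<lambda>x. a (g \<otimes> x)) \<in> C_inf G \<longleftrightarrow> a \<in> C_inf G"
  using left_translate_C_inf[of "\<lambda>x. a (g \<otimes> x)" "inv g"] left_translate_C_inf by (auto simp: mult_inv)

lemma ltrans_tangent:
  assumes v: "v \<in> tangent_space G p"
  shows "ltrans G g v \<in> tangent_space G (g \<otimes> p)"
  unfolding tangent_space_def ltrans_def
  by (simp add: tangent_vectorD[OF v] left_translate_C_inf left_translate_C_inf_iff)

lemma ltrans_one: "ltrans G \<one> v = v"
  by (simp add: ltrans_def mult_one)

lemma ltrans_inv: "ltrans G (inv g) (ltrans G g v) = v" "ltrans G g (ltrans G (inv g) v) = v"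
  using mult_inv[of g] by (simp_all add: ltrans_def)

lemma ltrans_tangent_iff: "ltrans G g v \<in> tangent_space G g \<longleftrightarrow> v \<in> lie_algebra G"
proof
  assume "ltrans G g v \<in> tangent_space G g"
  then have "ltrans G (inv g) (ltrans G g v) \<in> tangent_space G (inv g \<otimes> (g \<otimes> \<one>))"
    by (simp add: ltrans_tangent mult_one)
  then show "v \<in> lie_algebra G" by (simp add: ltrans_inv mult_inv lie_algebra_def)
next
  assume "v \<in> lie_algebra G"
  then show "ltrans G g v \<in> tangent_space G g"
    using ltrans_tangent[of v \<one> g] by (simp add: lie_algebra_def mult_one)
qed

lemma left_invariant_field_C_inf:
  assumes "f \<in> C_inf G" "v \<in> lie_algebra G"
  shows "(\<lambda>g. ltrans G g v f) \<in> C_inf G"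
  using partial_derivative_C_inf[OF C_inf2_swap[OF mult_C_inf2[OF assms(1)]], of v \<one>] assms(2)
  by (simp add: ltrans_def lie_algebra_def)

text \<open>The second-order terms of the commutator cancel, as for vector fields; the left invariant fields map
  smooth functions to smooth functions, so both summands of the bracket may be expanded.\<close>

lemma lie_bracket_closed:
  assumes v: "v \<in> lie_algebra G" and w: "w \<in> lie_algebra G"
  shows "lie_bracket G v w \<in> lie_algebra G"
proof -
  have v': "v \<in> tangent_space G \<one>" and w': "w \<in> tangent_space G \<one>"
    using v w by (simp_all add: lie_algebra_def)
  note D = tangent_vectorD[OF v'] tangent_vectorD[OF w']
  have L: "ltrans G g u \<in> tangent_space G g" if "u \<in> lie_algebra G" for g u
    using that by (simp add: ltrans_tangent_iff)
  note E = tangent_vectorD[OF L[OF v]] tangent_vectorD[OF L[OF w]]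
  have one: "ltrans G \<one> u = u" for u by (rule ltrans_one)
  note c = left_invariant_field_C_inf C_inf_add C_inf_mult C_inf_const v w
  show ?thesis
    unfolding lie_algebra_def tangent_space_def lie_bracket_def mem_Collect_eq
  proof (intro conjI ballI allI impI)
    fix f h assume f: "f \<in> C_inf G" and h: "h \<in> C_inf G"
    show "v (\<lambda>g. ltrans G g w (\<lambda>x. f x + h x)) - w (\<lambda>g. ltrans G g v (\<lambda>x. f x + h x)) =
      v (\<lambda>g. ltrans G g w f) - w (\<lambda>g. ltrans G g v f) + (v (\<lambda>g. ltrans G g w h) - w (\<lambda>g. ltrans G g v h))"
      using f h by (simp add: D(1,5) E(1,5) c)
    show "v (\<lambda>g. ltrans G g w (\<lambda>x. f x * h x)) - w (\<lambda>g. ltrans G g v (\<lambda>x. f x * h x)) =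
      f \<one> * (v (\<lambda>g. ltrans G g w h) - w (\<lambda>g. ltrans G g v h)) +
      (v (\<lambda>g. ltrans G g w f) - w (\<lambda>g. ltrans G g v f)) * h \<one>"
      using f h by (simp add: D(1,3,5,7) E(3,7) c one algebra_simps)
  next
    fix f k assume f: "f \<in> C_inf G"
    show "v (\<lambda>g. ltrans G g w (\<lambda>x. k * f x)) - w (\<lambda>g. ltrans G g v (\<lambda>x. k * f x)) =
      k * (v (\<lambda>g. ltrans G g w f) - w (\<lambda>g. ltrans G g v f))"
      using f by (simp add: D(2,6) E(2,6) c algebra_simps)
  next
    fix f assume f: "f \<notin> C_inf G"
    show "v (\<lambda>g. ltrans G g w f) - w (\<lambda>g. ltrans G g v f) = 0"
      using f by (simp add: E(4,8) tangent_vector_zero[OF v'] tangent_vector_zero[OF w'])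
  qed
qed

lemma differential_one_form: "a \<in> C_inf G \<Longrightarrow> differential G a \<in> one_forms G"
  unfolding one_forms_def cotangent_space_def vector_fields_def differential_def
  by (simp add: tangent_space_add tangent_space_scale)

lemma differential_in_lie_dual: "a \<in> C_inf G \<Longrightarrow> differential G a \<one> \<in> lie_dual G"
  using differential_one_form by (auto simp: lie_dual_def one_forms_def)

lemma lie_dual_is_differential:
  assumes "\<phi> \<in> lie_dual G"
  obtains a where "a \<in> C_inf G" "\<phi> = differential G a \<one>"
proof -
  have \<phi>: "\<phi> \<in> cotangent_space G \<one>" using assms by (simp add: lie_dual_def)
  obtain a where a: "a \<in> C_inf G" "\<And>v. v \<in> tangent_space G \<one> \<Longrightarrow> \<phi> v = v a"
    using cotangent_is_differential[OF \<phi>] by metis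
  have "\<phi> = differential G a \<one>"
    using \<phi> a(2) unfolding differential_def cotangent_space_def by (intro ext) simp
  with a(1) show thesis by (rule that)
qed

lemma Lhat_eq_differential: "Lhat G a g = differential G (\<lambda>x. a (g \<otimes> x)) \<one>"
  by (rule ext) (simp add: Lhat_def differential_def ltrans_tangent_iff, simp add: lie_algebra_def ltrans_def)

section \<open>Compatibility in terms of the cobracket\<close>

text \<open>The left invariant vector field of \<open>v\<close> fails to be a derivation of the Poisson bracket exactly by the
  left translate of the cobracket of \<open>v\<close>. Indeed multiplicativity writes \<open>{a, b} (g h)\<close>, as a function of
  \<open>h\<close>, as \<open>{a \<circ> L\<^sub>g, b \<circ> L\<^sub>g} h\<close> plus the contraction of \<open>\<omega> g\<close> with \<open>a \<circ> R\<^sub>h\<close> and \<open>b \<circ> R\<^sub>h\<close>. Differentiating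
  the first part at the identity gives the cobracket. In the second part the derivative in \<open>h\<close> is taken
  past the vectors of \<open>\<omega> g\<close>, which act on the other variable, and turns \<open>a \<circ> R\<^sub>h\<close> into the function
  \<open>x \<mapsto> (x v) a\<close>.\<close>

lemma multiplicative_bracket_derivative:
  assumes P: "poisson_lie_group G \<omega>" and v: "v \<in> lie_algebra G"
    and a: "a \<in> C_inf G" and b: "b \<in> C_inf G"
  shows "ltrans G g v (poisson_bracket \<omega> a b) =
    cobracket \<omega> v (\<lambda>x. a (g \<otimes> x)) (\<lambda>x. b (g \<otimes> x)) +
    poisson_bracket \<omega> (\<lambda>h. ltrans G h v a) b g + poisson_bracket \<omega> a (\<lambda>h. ltrans G h v b) g"
proof -
  have v': "v \<in> tangent_space G \<one>" using v by (simp add: lie_algebra_def)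
  have \<omega>: "set (\<omega> g) \<subseteq> tangent_space G g \<times> tangent_space G g"
    and PC: "\<And>a b. a \<in> C_inf G \<Longrightarrow> b \<in> C_inf G \<Longrightarrow> poisson_bracket \<omega> a b \<in> C_inf G"
    using P by (auto simp: poisson_lie_group_def poisson_bivector_def)
  let ?R = "\<lambda>z h. fst z (\<lambda>x. a (x \<otimes> h)) * snd z (\<lambda>x. b (x \<otimes> h))"
  let ?ab = "poisson_bracket \<omega> (\<lambda>x. a (g \<otimes> x)) (\<lambda>x. b (g \<otimes> x))"
  have split: "poisson_bracket \<omega> a b (g \<otimes> h) = ?ab h + (\<Sum>z\<leftarrow>\<omega> g. ?R z h)" for h
  proof -
    have "tensor2 (\<omega> (g \<otimes> h)) = tensor2 (map (map_prod (ltrans G g) (ltrans G g)) (\<omega> h) @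
                 map (map_prod (rtrans G h) (rtrans G h)) (\<omega> g))"
      using P unfolding poisson_lie_group_def by blast
    then have "tensor2 (\<omega> (g \<otimes> h)) a b = tensor2 (map (map_prod (ltrans G g) (ltrans G g)) (\<omega> h) @
                 map (map_prod (rtrans G h) (rtrans G h)) (\<omega> g)) a b"
      by (simp only:)
    then show ?thesis
      by (simp add: poisson_bracket_def tensor2_def ltrans_def rtrans_def o_def case_prod_unfold)
  qed
  have ab: "?ab \<in> C_inf G" by (intro PC left_translate_C_inf a b)
  have p: "(\<lambda>h. p (\<lambda>x. f (x \<otimes> h))) \<in> C_inf G"
    "v (\<lambda>h. p (\<lambda>x. f (x \<otimes> h))) = p (\<lambda>x. ltrans G x v f)"
    if "p \<in> tangent_space G g" "f \<in> C_inf G" for p f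
    using partial_derivative_C_inf[OF mult_C_inf2[OF that(2)] that(1)]
      partial_derivatives_commute[OF mult_C_inf2[OF that(2)] that(1) v'] by (simp_all add: ltrans_def)
  have z: "fst z \<in> tangent_space G g" "snd z \<in> tangent_space G g" if "z \<in> set (\<omega> g)" for z
    using \<omega> that by auto
  have R: "?R z \<in> C_inf G" "v (?R z) = fst z (\<lambda>h. ltrans G h v a) * snd z b + fst z a * snd z (\<lambda>h. ltrans G h v b)"
    if "z \<in> set (\<omega> g)" for z
  proof -
    note z = z[OF that]
    show "?R z \<in> C_inf G" by (intro C_inf_mult p(1) z a b)
    show "v (?R z) = fst z (\<lambda>h. ltrans G h v a) * snd z b + fst z a * snd z (\<lambda>h. ltrans G h v b)"
      using tangent_vectorD(3)[OF v' p(1)[OF z(1) a] p(1)[OF z(2) b]]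
      by (simp add: p(2)[OF z(1) a] p(2)[OF z(2) b] mult_one)
  qed
  have "ltrans G g v (poisson_bracket \<omega> a b) = v (\<lambda>h. ?ab h + (\<Sum>z\<leftarrow>\<omega> g. ?R z h))"
    by (simp only: ltrans_def split)
  also have "\<dots> = v ?ab + (\<Sum>z\<leftarrow>\<omega> g. v (?R z))"
    using tangent_vectorD(1)[OF v' ab C_inf_sum_list[of "\<omega> g" ?R]] R(1)
      tangent_vector_sum_list[OF v', of "\<omega> g" ?R] by simp
  also have "(\<Sum>z\<leftarrow>\<omega> g. v (?R z)) =
      (\<Sum>z\<leftarrow>\<omega> g. fst z (\<lambda>h. ltrans G h v a) * snd z b + fst z a * snd z (\<lambda>h. ltrans G h v b))"
    by (intro arg_cong[of _ _ sum_list] map_cong refl R(2))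
  also have "\<dots> = poisson_bracket \<omega> (\<lambda>h. ltrans G h v a) b g + poisson_bracket \<omega> a (\<lambda>h. ltrans G h v b) g"
    by (simp add: poisson_bracket_def tensor2_def case_prod_unfold sum_list_addf)
  finally show ?thesis by (simp add: cobracket_def)
qed

lemma preconnection_on_differential:
  assumes L: "left_invariant_preconnection G \<omega> \<gamma> \<Xi>" and v: "v \<in> lie_algebra G"
    and a: "a \<in> C_inf G" and b: "b \<in> C_inf G"
  shows "\<gamma> a (differential G b) g (ltrans G g v) =
    poisson_bracket \<omega> a (\<lambda>h. ltrans G h v b) g + \<Xi> (Lhat G a g) (Lhat G b g) v"
proof -
  have "\<gamma> a (differential G b) g (ltrans G g v) = tilde G (\<gamma> a (differential G b)) g v"
    by (simp add: tilde_def)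
  also have "\<dots> =
      dual_bracket \<omega> a (tilde G (differential G b)) g v + \<Xi> (Lhat G a g) (tilde G (differential G b) g) v"
    using L a differential_one_form[OF b] unfolding left_invariant_preconnection_def by metis
  also have "tilde G (differential G b) = Lhat G b"
    by (simp add: tilde_def Lhat_def fun_eq_iff)
  also have "dual_bracket \<omega> a (Lhat G b) g v = poisson_bracket \<omega> a (\<lambda>h. ltrans G h v b) g"
    using v by (simp add: dual_bracket_def Lhat_def differential_def ltrans_tangent_iff)
  finally show ?thesis .
qed

text \<open>Both sides of the compatibility condition are evaluated on \<open>g v\<close>. The Poisson bracket terms in the
  preconnection are those of the previous Leibniz rule and cancel, leaving the antisymmetrisation of \<open>\<Xi>\<close>
  against the cobracket. What remains involves \<open>g\<close> only through \<open>a \<circ> L\<^sub>g\<close> and \<open>b \<circ> L\<^sub>g\<close>, which are again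
  arbitrary smooth functions, so it suffices to look at the identity.\<close>

lemma compatible_iff_cobracket:
  assumes P: "poisson_lie_group G \<omega>" and L: "left_invariant_preconnection G \<omega> \<gamma> \<Xi>"
  shows "compatible G \<omega> \<gamma> \<longleftrightarrow> (\<forall>a\<in>C_inf G. \<forall>b\<in>C_inf G. \<forall>v\<in>lie_algebra G.
    cobracket \<omega> v a b = \<Xi> (differential G a \<one>) (differential G b \<one>) v -
      \<Xi> (differential G b \<one>) (differential G a \<one>) v)"  (is "_ \<longleftrightarrow> ?rhs")
proof -
  let ?\<Xi> = "\<lambda>a b v. \<Xi> (differential G a \<one>) (differential G b \<one>) v - \<Xi> (differential G b \<one>) (differential G a \<one>) v"
  have B: "poisson_bivector G \<omega>" using P by (simp add: poisson_lie_group_def)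
  have pointwise: "differential G (poisson_bracket \<omega> a b) g (ltrans G g v) =
      \<gamma> a (differential G b) g (ltrans G g v) - \<gamma> b (differential G a) g (ltrans G g v) \<longleftrightarrow>
      cobracket \<omega> v (\<lambda>x. a (g \<otimes> x)) (\<lambda>x. b (g \<otimes> x)) = ?\<Xi> (\<lambda>x. a (g \<otimes> x)) (\<lambda>x. b (g \<otimes> x)) v"
    if v: "v \<in> lie_algebra G" and a: "a \<in> C_inf G" and b: "b \<in> C_inf G" for a b g v
  proof -
    have "poisson_bracket \<omega> (\<lambda>h. ltrans G h v a) b g = - poisson_bracket \<omega> b (\<lambda>h. ltrans G h v a) g"
      using B b left_invariant_field_C_inf[OF a v] unfolding poisson_bivector_def by blast
    moreover have "differential G (poisson_bracket \<omega> a b) g (ltrans G g v) = ltrans G g v (poisson_bracket \<omega> a b)"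
      using v by (simp add: differential_def ltrans_tangent_iff)
    ultimately show ?thesis
      unfolding multiplicative_bracket_derivative[OF P v a b] preconnection_on_differential[OF L v a b]
        preconnection_on_differential[OF L v b a] Lhat_eq_differential by auto
  qed
  show ?thesis
  proof
    assume C: "compatible G \<omega> \<gamma>"
    show ?rhs
    proof (intro ballI)
      fix a b v assume a: "a \<in> C_inf G" and b: "b \<in> C_inf G" and v: "v \<in> lie_algebra G"
      have "differential G (poisson_bracket \<omega> a b) =
          (\<lambda>g u. \<gamma> a (differential G b) g u - \<gamma> b (differential G a) g u)"
        using C a b unfolding compatible_def by blast
      then show "cobracket \<omega> v a b = ?\<Xi> a b v"
        using pointwise[OF v a b, of \<one>] by (simp add: mult_one)
    qed
  next
    assume R: ?rhs
    show "compatible G \<omega> \<gamma>"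
      unfolding compatible_def
    proof (intro ballI ext)
      fix a b g u assume a: "a \<in> C_inf G" and b: "b \<in> C_inf G"
      show "differential G (poisson_bracket \<omega> a b) g u =
          \<gamma> a (differential G b) g u - \<gamma> b (differential G a) g u"
      proof (cases "u \<in> tangent_space G g")
        case True
        define v where "v = ltrans G (inv g) u"
        have u: "u = ltrans G g v" by (simp add: v_def ltrans_inv)
        then have "v \<in> lie_algebra G" using True by (simp add: ltrans_tangent_iff)
        then show ?thesis
          unfolding u using pointwise[of v a b g] R a b left_translate_C_inf by blast
      next
        case False
        have "\<gamma> x (differential G y) g u = 0" if "x \<in> C_inf G" "y \<in> C_inf G" for x y
        proof -
          have "\<gamma> x (differential G y) \<in> one_forms G"
            using L that(1) differential_one_form[OF that(2)]
            unfolding left_invariant_preconnection_def preconnection_def by blast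
          then show ?thesis using False by (simp add: one_forms_def cotangent_space_def)
        qed
        then show ?thesis using False a b by (simp add: differential_def)
      qed
    qed
  qed
qed

text \<open>Antisymmetry of the Poisson bracket makes the cobracket antisymmetric, so only the antisymmetric part
  of \<open>ad\<^sub>w r\<close>, that is \<open>ad\<^sub>w r\<^sub>-\<close>, contributes. Since \<open>r\<^sub>-\<close> is itself antisymmetric, the two terms of
  \<open>ad\<^sub>w r\<^sub>-\<close> are obtained from one another by exchanging \<open>a\<close> and \<open>b\<close> and changing the sign.\<close>

lemma cobracket_r_minus:
  assumes P: "poisson_lie_group G \<omega>" and Q: "quasitriangular_structure G \<omega> r"
    and a: "a \<in> C_inf G" and b: "b \<in> C_inf G" and w: "w \<in> lie_algebra G"
  defines "S \<equiv> \<lambda>a b. \<Sum>(p, q)\<leftarrow>r_minus r. differential G a \<one> p * coadjoint G q (differential G b \<one>) w"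
  shows "cobracket \<omega> w a b = S a b - S b a"
proof -
  have r: "p \<in> lie_algebra G" "q \<in> lie_algebra G" if "(p, q) \<in> set r" for p q
    using Q that by (auto simp: quasitriangular_structure_def)
  have w': "w \<in> tangent_space G \<one>" using w by (simp add: lie_algebra_def)
  have T: "cobracket \<omega> w = tensor2 (ad_tensor G w r)"
    using Q w by (simp add: quasitriangular_structure_def)
  have B: "poisson_bivector G \<omega>" using P by (simp add: poisson_lie_group_def)
  have "poisson_bracket \<omega> a b g = - 1 * poisson_bracket \<omega> b a g" for g
  proof -
    have "poisson_bracket \<omega> a b g = - poisson_bracket \<omega> b a g"
      using B a b unfolding poisson_bivector_def by blast
    then show ?thesis by linarith
  qed
  then have "poisson_bracket \<omega> a b = (\<lambda>g. - 1 * poisson_bracket \<omega> b a g)" by (rule ext)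
  moreover have "poisson_bracket \<omega> b a \<in> C_inf G"
    using B a b unfolding poisson_bivector_def by blast
  ultimately have "cobracket \<omega> w a b = - cobracket \<omega> w b a"
    using tangent_vectorD(2)[OF w', of "poisson_bracket \<omega> b a" "- 1"] by (simp add: cobracket_def)
  then have "cobracket \<omega> w a b = (cobracket \<omega> w a b - cobracket \<omega> w b a) / 2"
    by simp
  moreover have "cobracket \<omega> w a b =
      (\<Sum>z\<leftarrow>r. lie_bracket G w (fst z) a * snd z b + fst z a * lie_bracket G w (snd z) b)" for a b
    by (simp add: T tensor2_def ad_tensor_def o_def case_prod_unfold sum_list_addf)
  ultimately have cb: "cobracket \<omega> w a b =
    ((\<Sum>z\<leftarrow>r. lie_bracket G w (fst z) a * snd z b + fst z a * lie_bracket G w (snd z) b) -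
     (\<Sum>z\<leftarrow>r. lie_bracket G w (fst z) b * snd z a + fst z b * lie_bracket G w (snd z) a)) / 2"
    by (simp only:)
  have d: "differential G f \<one> v = v f" if "v \<in> lie_algebra G" for f v
    using that by (simp add: differential_def lie_algebra_def)
  have S: "S f h = (\<Sum>z\<leftarrow>r. fst z f * lie_bracket G w (snd z) h / 2 - snd z f * lie_bracket G w (fst z) h / 2)"
    for f h
  proof -
    have half: "(\<lambda>f. p f / 2) \<in> lie_algebra G" "(\<lambda>f. - (p f / 2)) \<in> lie_algebra G"
      if "p \<in> lie_algebra G" for p
      using tangent_space_scale[of p \<one> "1 / 2"] tangent_space_scale[of p \<one> "- 1 / 2"] that
      by (simp_all add: lie_algebra_def)
    have "S f h = (\<Sum>z\<leftarrow>r. differential G f \<one> (\<lambda>f. fst z f / 2) * coadjoint G (snd z) (differential G h \<one>) w +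
        differential G f \<one> (\<lambda>f. - snd z f / 2) * coadjoint G (fst z) (differential G h \<one>) w)"
      by (simp add: S_def r_minus_def o_def case_prod_unfold sum_list_addf)
    also have "\<dots> = (\<Sum>z\<leftarrow>r. fst z f * lie_bracket G w (snd z) h / 2 - snd z f * lie_bracket G w (fst z) h / 2)"
    proof (intro arg_cong[of _ _ sum_list] map_cong refl)
      fix z assume "z \<in> set r"
      then have z: "fst z \<in> lie_algebra G" "snd z \<in> lie_algebra G" using r[of "fst z" "snd z"] by simp_all
      show "differential G f \<one> (\<lambda>f. fst z f / 2) * coadjoint G (snd z) (differential G h \<one>) w +
        differential G f \<one> (\<lambda>f. - snd z f / 2) * coadjoint G (fst z) (differential G h \<one>) w =
        fst z f * lie_bracket G w (snd z) h / 2 - snd z f * lie_bracket G w (fst z) h / 2"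
        using w z by (simp add: coadjoint_def d half lie_bracket_closed)
    qed
    finally show ?thesis .
  qed
  show ?thesis
    unfolding cb S sum_list_subtractf[symmetric]
    by (induction r) (simp_all add: field_simps)
qed

end

theorem corollary4p7:
  fixes G :: "('g::{t2_space, second_countable_topology}, 'e::euclidean_space) lie_group"
    and \<omega> :: "'g \<Rightarrow> 'g tens2"
    and r :: "'g tens2"
    and \<gamma> :: "('g \<Rightarrow> real) \<Rightarrow> 'g form \<Rightarrow> 'g form"
    and \<Xi> :: "('g tvec \<Rightarrow> real) \<Rightarrow> ('g tvec \<Rightarrow> real) \<Rightarrow> ('g tvec \<Rightarrow> real)"
  assumes "poisson_lie_group G \<omega>"
    and "quasitriangular_structure G \<omega> r"
    and "left_invariant_preconnection G \<omega> \<gamma> \<Xi>"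
  shows "compatible G \<omega> \<gamma> \<longleftrightarrow>
    (\<forall>\<phi>\<in>lie_dual G. \<forall>\<psi>\<in>lie_dual G. Xi_hat G r \<Xi> \<phi> \<psi> = Xi_hat G r \<Xi> \<psi> \<phi>)"
proof -
  interpret real_lie_group G
    using assms(1) by unfold_locales (simp add: poisson_lie_group_def)
  let ?d = "\<lambda>a. differential G a \<one>\<^bsub>G\<^esub>"
  have pointwise: "Xi_hat G r \<Xi> (?d a) (?d b) w = Xi_hat G r \<Xi> (?d b) (?d a) w \<longleftrightarrow>
      cobracket \<omega> w a b = \<Xi> (?d a) (?d b) w - \<Xi> (?d b) (?d a) w"
    if "a \<in> C_inf G" "b \<in> C_inf G" "w \<in> lie_algebra G" for a b w
    unfolding Xi_hat_def cobracket_r_minus[OF assms(1,2) that] by linarith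
  \<comment> \<open>Off the Lie algebra all functionals are zero by convention.\<close>
  have outside: "Xi_hat G r \<Xi> \<phi> \<psi> w = 0"
    if "\<phi> \<in> lie_dual G" "\<psi> \<in> lie_dual G" "w \<notin> lie_algebra G" for \<phi> \<psi> w
  proof -
    have "\<Xi> \<phi> \<psi> \<in> lie_dual G"
      using assms(3) that(1,2) unfolding left_invariant_preconnection_def bilinear_on_dual_def by blast
    then show ?thesis
      using that(3) by (simp add: Xi_hat_def coadjoint_def lie_dual_def cotangent_space_def
          lie_algebra_def case_prod_unfold)
  qed
  show ?thesis
    unfolding compatible_iff_cobracket[OF assms(1,3)]
  proof (intro iffI ballI ext)
    fix \<phi> \<psi> w
    assume C: "\<forall>a\<in>C_inf G. \<forall>b\<in>C_inf G. \<forall>v\<in>lie_algebra G.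
        cobracket \<omega> v a b = \<Xi> (?d a) (?d b) v - \<Xi> (?d b) (?d a) v"
      and \<phi>: "\<phi> \<in> lie_dual G" and \<psi>: "\<psi> \<in> lie_dual G"
    obtain a where a: "a \<in> C_inf G" "\<phi> = ?d a" using \<phi> by (rule lie_dual_is_differential)
    obtain b where b: "b \<in> C_inf G" "\<psi> = ?d b" using \<psi> by (rule lie_dual_is_differential)
    show "Xi_hat G r \<Xi> \<phi> \<psi> w = Xi_hat G r \<Xi> \<psi> \<phi> w"
    proof (cases "w \<in> lie_algebra G")
      case True
      then show ?thesis using C a b pointwise by blast
    next
      case False
      then show ?thesis using \<phi> \<psi> outside by simp
    qed
  next
    fix a b w
    assume S: "\<forall>\<phi>\<in>lie_dual G. \<forall>\<psi>\<in>lie_dual G. Xi_hat G r \<Xi> \<phi> \<psi> = Xi_hat G r \<Xi> \<psi> \<phi>"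
      and ab: "a \<in> C_inf G" "b \<in> C_inf G" and w: "w \<in> lie_algebra G"
    have "Xi_hat G r \<Xi> (?d a) (?d b) = Xi_hat G r \<Xi> (?d b) (?d a)"
      using S ab differential_in_lie_dual by blast
    then show "cobracket \<omega> w a b = \<Xi> (?d a) (?d b) w - \<Xi> (?d b) (?d a) w"
      using pointwise[OF ab w] by simp
  qed
qed

end
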